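(* Let $n$ be a positive integer and let $A\subseteq\mathbb{Z}_5^n$ satisfy $3A\ne\mathbb{Z}_5^n$. If $|A|>3\cdot 5^{n-1}/2$, then $A$ is contained in a union of two cosets of a subgroup of $\mathbb{Z}_5^n$ of index $5$. Moreover, $$\mathcal{N}_3(\mathbb{Z}_5^n)=\begin{cases}2 & \text{if } n=1,\\ \tfrac12\,(3\cdot 5^{n-1}-1) & \text{if } n\ge 2.\end{cases}$$
   Context: $\mathbb{Z}_5^n$ denotes the elementary abelian group of order $5^n$ (written additively). For a subset $A$ of an abelian group $G$ and a positive integer $k$, $kA:=\{a_1+\dots+a_k\colon a_1,\dots,a_k\in A\}$ is the $k$-fold sumset. The period of $A\subseteq G$ is $\pi(A):=\{g\in G\colon A+g=A\}$; $A$ is aperiodic if $\pi(A)=\{0\}$. For a finite abelian group $G$ and integer $k\ge1$, $\mathcal{N}_k(G)$ is the largest size $|A|$ of a subset $A\subseteq G$ such that $\pi(A)=\{0\}$, $kA\ne G$, and $k(A\cup\{g\})=G$ for every $g\in G\setminus A$ (with the convention $\max\emptyset=0$). *)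

theory Defs
  imports Complex_Main "HOL-Algebra.FiniteProduct" "HOL-Algebra.Product_Groups"
    "HOL-Algebra.Elementary_Groups"
begin

text \<open>Abelian groups are those of \<open>HOL-Algebra\<close>, so the group operation is
  written multiplicatively throughout.\<close>

definition Z5_power :: "nat \<Rightarrow> (nat \<Rightarrow> int) monoid"
  where "Z5_power n = product_group {..<n} (\<lambda>_. integer_mod_group 5)"

definition fold_sumset :: "('a, 'b) monoid_scheme \<Rightarrow> nat \<Rightarrow> 'a set \<Rightarrow> 'a set"
  where "fold_sumset G k A = {finprod G a {1..k} | a. a \<in> {1..k} \<rightarrow> A}"

definition period :: "('a, 'b) monoid_scheme \<Rightarrow> 'a set \<Rightarrow> 'a set"
  where "period G A = {g \<in> carrier G. A #>\<^bsub>G\<^esub> g = A}"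

definition aperiodic :: "('a, 'b) monoid_scheme \<Rightarrow> 'a set \<Rightarrow> bool"
  where "aperiodic G A \<longleftrightarrow> period G A = {\<one>\<^bsub>G\<^esub>}"

definition max_noncovering :: "('a, 'b) monoid_scheme \<Rightarrow> nat \<Rightarrow> 'a set \<Rightarrow> bool"
  where "max_noncovering G k A \<longleftrightarrow>
    fold_sumset G k A \<noteq> carrier G \<and>
    (\<forall>g \<in> carrier G - A. fold_sumset G k (insert g A) = carrier G)"

text \<open>For finite \<open>G\<close>; the inserted \<open>0\<close> implements the convention
  \<open>max \<emptyset> = 0\<close>.\<close>

definition N_max :: "nat \<Rightarrow> ('a, 'b) monoid_scheme \<Rightarrow> nat"
  where "N_max k G =
    Max (insert 0 {card A | A. A \<subseteq> carrier G \<and> aperiodic G A \<and> max_noncovering G k A})"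

lemma comm_group_Z5_power: "comm_group (Z5_power n)"
proof -
  have "group (Z5_power n)"
    by (simp add: Z5_power_def)
  then show ?thesis
    by (rule group.group_comm_groupI) (auto simp: Z5_power_def add.commute)
qed

lemma order_Z5_power: "order (Z5_power n) = 5 ^ n"
  by (simp add: order_def Z5_power_def card_PiE carrier_integer_mod_group)

end

theory Submission
  imports Defs
begin

text \<open>
  After a translation assume \<open>0 \<notin> 3A\<close>. For \<open>u \<in> \<int>\<^sub>5\<^sup>n\<close> let \<open>a\<^sub>i\<close> be the number of \<open>x \<in> A\<close> with
  \<open>u \<cdot> x = i\<close>, and put \<open>S = |A|\<close>, \<open>T = \<Sum>\<^bsub>i+j+k=0\<^esub> a\<^sub>i a\<^sub>j a\<^sub>k\<close>, \<open>Q = \<Sum>\<^sub>i a\<^sub>i\<^sup>2\<close>. Double counting over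
  all \<open>u\<close> shows that \<open>7T + 3SQ - 2S\<^sup>3\<close> sums to \<open>12 \<cdot> 5\<^bsup>n-1\<^esup> S\<^sup>2\<close>, of which \<open>u = 0\<close> contributes
  \<open>8S\<^sup>3\<close>; so if \<open>2S > 3 \<cdot> 5\<^bsup>n-1\<^esup>\<close>, the cubic is negative for some \<open>u \<noteq> 0\<close>.

  On the other hand the slices satisfy \<open>a\<^sub>i + a\<^sub>j \<le> m = 5\<^bsup>n-1\<^esup>\<close> whenever \<open>i + j + k = 0\<close> and \<open>a\<^sub>k > 0\<close>
  (pigeonhole), and \<open>3a\<^sub>j + 2a\<^sub>k \<le> 2m\<close> whenever \<open>2j + k = 0\<close>, \<open>a\<^sub>k > 0\<close> and \<open>5a\<^sub>j > m\<close> (a set \<open>B\<close> with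
  \<open>|2B| < 3|B|/2\<close> is more than half of a coset of a subgroup). Under these constraints the cubic is
  nonnegative unless at most two slices are nonempty.

  For \<open>n \<ge> 2\<close> the value of \<open>N\<^sub>3\<close> is attained at \<open>{e} \<union> (2e + B) \<union> (3e + (F - {0}))\<close>, where \<open>F\<close> has
  index \<open>5\<close>, \<open>e \<notin> F\<close> and \<open>F - {0}\<close> is the disjoint union of \<open>B\<close> and \<open>-B\<close>; its threefold sumset misses exactly \<open>0\<close>.
\<close>


section \<open>A cubic inequality\<close>

text \<open>The first bracket is \<open>T\<close>, the number of triples from classes of sizes
  \<open>a0\<close>, ..., \<open>a4\<close> whose class indices sum to 0 modulo 5; the whole is
  \<open>7T + 3SQ - 2S^3\<close>.\<close>

definition cubic_form :: "real \<Rightarrow> real \<Rightarrow> real \<Rightarrow> real \<Rightarrow> real \<Rightarrow> real"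
  where "cubic_form a0 a1 a2 a3 a4 =
    7 * (a0^3 + 6 * a0 * (a1 * a4 + a2 * a3) +
      3 * (a1^2 * a3 + a2^2 * a1 + a3^2 * a4 + a4^2 * a2)) +
    3 * (a0 + a1 + a2 + a3 + a4) * (a0^2 + a1^2 + a2^2 + a3^2 + a4^2) -
    2 * (a0 + a1 + a2 + a3 + a4)^3"

lemma cubic_form_nonneg_of_large_slice:
  assumes "3 * (a0 + a1) \<le> 2 * (a0 + a1 + a2 + a4)"
    and "3 * (a1 + a4) \<le> 2 * (a0 + a1 + a2 + a4)"
    and "6 * a1 + 9 * a2 \<le> 4 * (a0 + a1 + a2 + a4)"
    and "a0 + a1 + a2 + a4 \<le> 3 * a1"
  shows "0 \<le> cubic_form a0 a1 a2 0 a4"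
proof -
  \<comment> \<open>In the coordinates of the simplicial cone cut out by the hypotheses all coefficients of the
    cubic are positive.\<close>
  define u v w t where "u = 2 * a2 + 2 * a4 - a0 - a1" and "v = 2 * a0 + 2 * a2 - a1 - a4"
    and "w = 4 * a0 + 4 * a4 - 2 * a1 - 5 * a2" and "t = 2 * a1 - a0 - a2 - a4"
  have nn: "0 \<le> u" "0 \<le> v" "0 \<le> w" "0 \<le> t"
    using assms by (auto simp: u_def v_def w_def t_def)
  have "108 * cubic_form a0 a1 a2 0 a4 =
      89*u^3 + 180*u^2*v + 57*u^2*w + 213*u^2*t + 75*u*v^2 + 120*u*v*w + 456*u*v*t
      + 39*u*w^2 + 186*u*w*t + 255*u*t^2 + 12*v^3 + 57*v^2*w + 45*v^2*t + 60*v*w^2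
      + 228*v*w*t + 192*v*t^2 + 11*w^3 + 105*w^2*t + 213*w*t^2 + 123*t^3"
    unfolding cubic_form_def u_def v_def w_def t_def
    by (simp add: power2_eq_square power3_eq_cube algebra_simps)
  also have "\<dots> \<ge> 0"
    using nn by (intro add_nonneg_nonneg mult_nonneg_nonneg zero_le_power) auto
  finally show ?thesis by simp
qed

text \<open>Since \<open>- s \<le> g\<close>, only the second summand can be negative, and then the
  largest admissible \<open>f\<close> is the worst case. There the cubic is \<open>s + g\<close>
  times a positive definite quadratic form.\<close>

lemma binary_cubic_nonneg:
  fixes s g f :: real
  assumes "- s \<le> g" "0 \<le> f" "15 * f \<le> 8 * s + 3 * g" "0 \<le> s"
  shows "0 \<le> g^2 * (7 * g + 12 * s) + 15 * f^2 * (7 * g + 4 * s)"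
proof (cases "0 \<le> 7 * g + 4 * s")
  case True
  moreover have "0 \<le> 7 * g + 12 * s" using True assms by simp
  ultimately show ?thesis by simp
next
  case False
  have "(15 * f)^2 \<le> (8 * s + 3 * g)^2"
    using assms by (intro power_mono) auto
  then have "(15 * f)^2 * (- 7 * g - 4 * s) \<le> (8 * s + 3 * g)^2 * (- 7 * g - 4 * s)"
    using False by (intro mult_right_mono) auto
  moreover have "15 * (g^2 * (7 * g + 12 * s)) - (8 * s + 3 * g)^2 * (- 7 * g - 4 * s)
      = 8 * (s + g) * (21 * (g + 8/7 * s)^2 + 32/7 * s^2)"
    by algebra
  moreover have "0 \<le> 8 * (s + g) * (21 * (g + 8/7 * s)^2 + 32/7 * s^2)"
    by (rule mult_nonneg_nonneg) (use assms in auto)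
  moreover have "(15 * f)^2 * (- 7 * g - 4 * s) = - 15 * (15 * f^2 * (7 * g + 4 * s))"
    by algebra
  ultimately show ?thesis by linarith
qed

lemma cubic_form_nonneg_of_small_slices:
  assumes "0 \<le> a0" "0 \<le> a1" "0 \<le> a2" "0 \<le> a3" "0 \<le> a4"
    and s: "s = a0 + a1 + a2 + a3 + a4"
    and "15 * a0 \<le> 4 * s" "3 * a1 \<le> s" "3 * a2 \<le> s" "3 * a3 \<le> s" "3 * a4 \<le> s"
    and "a2 + a3 \<le> a1 + a4"
  shows "0 \<le> cubic_form a0 a1 a2 a3 a4"
proof -
  \<comment> \<open>\<open>g\<close> and \<open>f\<close> are the even, \<open>p\<close> and \<open>q\<close> the odd coordinates under \<open>a\<^sub>i \<mapsto> a\<^sub>-\<^sub>i\<close>.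
    Equality holds at \<open>(1, 1, 1, 1, 1)\<close> and at \<open>(0, 2, 1, 1, 2)\<close>, so there is no slack in the bounds below.\<close>
  define g f p q where "g = 4 * a0 - a1 - a2 - a3 - a4" and "f = a1 + a4 - a2 - a3"
    and "p = a1 - a4" and "q = a2 - a3"
  define b where "b = g^2 * (7 * g + 12 * s) + 15 * f^2 * (7 * g + 4 * s)"
  have form: "80 * cubic_form a0 a1 a2 a3 a4 =
      b + 30 * ((4*s - 7*g - 21*f) * p^2 + (4*s - 7*g - 7*f) * q^2 + 14 * f * (p - q)^2)"
    unfolding cubic_form_def b_def g_def f_def p_def q_def s by algebra
  have s0: "0 \<le> s" and f0: "0 \<le> f" and gs: "- s \<le> g" "3 * g \<le> s"
    using assms by (auto simp: g_def f_def)
  \<comment> \<open>These bound the odd coordinates: \<open>\<bar>p\<bar> \<le> D / 30\<close> comes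
    from \<open>3 * a1 \<le> s\<close> and \<open>3 * a4 \<le> s\<close>, and
    \<open>\<bar>q\<bar> \<le> E / 10\<close> from the nonnegativity of \<open>a2\<close> and
    \<open>a3\<close>.\<close>
  define D where "D = 8 * s + 3 * g - 15 * f"
  define E where "E = 4 * s - g - 5 * f"
  have D: "\<bar>30 * p\<bar> \<le> D" and E: "\<bar>10 * q\<bar> \<le> E"
    using assms by (auto simp: D_def E_def g_def f_def p_def q_def)
  have D2: "900 * p^2 \<le> D^2"
    using D power_mono[of "\<bar>30 * p\<bar>" D 2] by (simp add: power_mult_distrib)
  have E2: "100 * q^2 \<le> E^2"
    using E power_mono[of "\<bar>10 * q\<bar>" E 2] by (simp add: power_mult_distrib)
  have D0: "0 \<le> D" and E0: "0 \<le> E" using D E by auto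
  have b0: "0 \<le> b"
    unfolding b_def using s0 f0 gs D0 by (intro binary_cubic_nonneg) (auto simp: D_def)
  have r0: "0 \<le> 14 * f * (p - q)^2" using f0 by simp
  define x where "x = s - 3 * g"
  have x0: "0 \<le> x" using gs by (simp add: x_def)
  \<comment> \<open>The cases follow the signs of the coefficients of \<open>p^2\<close> and
    \<open>q^2\<close>: both nonnegative, only that of \<open>p^2\<close> nonpositive, both
    nonpositive. A square with nonpositive coefficient is replaced by its upper bound from
    \<open>D2\<close> or \<open>E2\<close>, and the term with \<open>(p - q)^2\<close> is
    dropped.\<close>
  consider "21 * f + 7 * g \<le> 4 * s" | "4 * s \<le> 21 * f + 7 * g" "7 * f + 7 * g \<le> 4 * s"
    | "4 * s \<le> 7 * f + 7 * g" by linarith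
  then show ?thesis
  proof cases
    case 1
    then have "0 \<le> (4*s - 7*g - 21*f) * p^2" "0 \<le> (4*s - 7*g - 7*f) * q^2"
      using f0 by auto
    then show ?thesis using form b0 r0 by simp
  next
    case 2
    define c where "c = 21 * f + 7 * g - 4 * s"
    have c0: "0 \<le> c" using 2 by (simp add: c_def)
    have "c * (900 * p^2) \<le> c * D^2" using D2 c0 by (rule mult_left_mono)
    moreover have "0 \<le> (4*s - 7*g - 7*f) * q^2" using 2 by auto
    moreover have "(4*s - 7*g - 21*f) * p^2 = - (c * p^2)" unfolding c_def by algebra
    ultimately have le: "30 * b - c * D^2 \<le> 30 * (80 * cubic_form a0 a1 a2 a3 a4)"
      using form r0 by simp
    \<comment> \<open>Here \<open>s\<close>, \<open>g\<close>, \<open>f\<close> are expressed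
      through the nonnegative quantities \<open>c\<close>, \<open>D\<close>, \<open>x\<close>; the
      factor \<open>275684 = 4 * 41^3\<close> clears denominators. The square of
      \<open>D - 2 * c\<close> absorbs the only negative coefficient.\<close>
    have "275684 * (30 * b - c * D^2) =
        226500 * c^3 + D * (24196 * (D - 2 * c)^2 + 13849 * D^2 + 328691 * c^2)
        + 900900 * x * c^2 + 1353200 * x * D * c + 34580 * x * D^2
        + 1290400 * x^2 * c + 2196880 * x^2 * D + 616000 * x^3"
      unfolding b_def c_def D_def x_def by algebra
    also have "\<dots> \<ge> 0"
      using x0 c0 D0 zero_le_power2[of "D - 2 * c"]
      by (intro add_nonneg_nonneg mult_nonneg_nonneg) auto
    finally have "0 \<le> 30 * b - c * D^2"
      by (simp only: zero_le_mult_iff) simp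
    with le show ?thesis by simp
  next
    case 3
    define c where "c = 7 * f + 7 * g - 4 * s"
    have c0: "0 \<le> c" using 3 by (simp add: c_def)
    have "(c + 14 * f) * (900 * p^2) \<le> (c + 14 * f) * D^2" using D2 c0 f0 by (intro mult_left_mono) auto
    moreover have "c * (100 * q^2) \<le> c * E^2" using E2 c0 by (rule mult_left_mono)
    moreover have "(4*s - 7*g - 21*f) * p^2 = - ((c + 14 * f) * p^2)"
      "(4*s - 7*g - 7*f) * q^2 = - (c * q^2)" unfolding c_def by algebra+
    ultimately have le: "30 * b - (c + 14 * f) * D^2 - 9 * c * E^2 \<le> 30 * (80 * cubic_form a0 a1 a2 a3 a4)"
      using form r0 by (simp add: algebra_simps)
    \<comment> \<open>The same change of coordinates with the new \<open>c\<close>;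
      \<open>61731 = 9 * 19^3\<close> clears denominators, and all coefficients are
      positive.\<close>
    have "61731 * (30 * b - (c + 14 * f) * D^2 - 9 * c * E^2) =
        4038525 * c^3 + 3381345 * D * c^2 + 543411 * D^2 * c + 42875 * D^3
        + 27013500 * x * c^2 + 15267240 * x * D * c + 1545012 * x * D^2
        + 60487200 * x^2 * c + 18427920 * x^2 * D + 46155200 * x^3"
      unfolding b_def c_def D_def E_def x_def by algebra
    also have "\<dots> \<ge> 0"
      using x0 c0 D0 by (intro add_nonneg_nonneg mult_nonneg_nonneg zero_le_power) auto
    finally have "0 \<le> 30 * b - (c + 14 * f) * D^2 - 9 * c * E^2"
      by (simp only: zero_le_mult_iff) simp
    with le show ?thesis by simp
  qed
qed

text \<open>Slice 1 exceeds a third of the total, hence \<open>m / 2\<close>, so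
  \<open>1 + 1 + 3 = 5\<close> forces slice 3 to be empty. If at most one of the slices 0, 2, 4 is
  nonempty, two slices carry everything; if exactly two are, \<open>C1\<close> bounds the total by
  \<open>3m/2\<close>; if all three are, the cubic is nonnegative.\<close>

lemma slice_dichotomy_of_large_slice:
  fixes n :: "int \<Rightarrow> real"
  assumes nonneg: "\<And>i. 0 \<le> n i"
    and C1: "\<And>i j k. i \<in> {0..<5} \<Longrightarrow> j \<in> {0..<5} \<Longrightarrow> k \<in> {0..<5} \<Longrightarrow>
      (i + j + k) mod 5 = 0 \<Longrightarrow> 0 < n k \<Longrightarrow> n i + n j \<le> m"
    and C2: "\<And>j k. j \<in> {0..<5} \<Longrightarrow> k \<in> {0..<5} \<Longrightarrow>
      (2 * j + k) mod 5 = 0 \<Longrightarrow> 0 < n k \<Longrightarrow> m < 5 * n j \<Longrightarrow> 3 * n j + 2 * n k \<le> 2 * m"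
    and S: "3 * m < 2 * (n 0 + n 1 + n 2 + n 3 + n 4)"
    and large: "n 0 + n 1 + n 2 + n 3 + n 4 < 3 * n 1"
  shows "0 \<le> cubic_form (n 0) (n 1) (n 2) (n 3) (n 4) \<or>
    (\<exists>p\<in>{0..<5}. \<exists>q\<in>{0..<5}. p \<noteq> q \<and> (\<forall>i\<in>{0..<5} - {p, q}. n i = 0))"
proof -
  have pos: "0 < n i \<or> n i = 0" for i
    using nonneg[of i] by linarith
  have n1: "0 < n 1" using large nonneg[of 0] nonneg[of 1] nonneg[of 2] nonneg[of 3] nonneg[of 4] by linarith
  have n3: "n 3 = 0"
    using C1[of 1 1 3] pos[of 3] S large by force
  have two: "?thesis" if "q \<in> {0,2,4}" "\<And>i. i \<in> {0,2,4} - {q} \<Longrightarrow> n i = 0" for q :: int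
  proof -
    have "n i = 0" if "i \<in> {0..<5} - {1, q}" for i
    proof -
      have "i = 3 \<or> i \<in> {0,2,4} - {q}"
        using that by auto
      then show ?thesis using n3 \<open>\<And>i. i \<in> {0,2,4} - {q} \<Longrightarrow> n i = 0\<close> by blast
    qed
    then show ?thesis using \<open>q \<in> {0,2,4}\<close>
      by (intro disjI2 bexI[of _ 1] bexI[of _ q]) auto
  qed
  consider "n 2 = 0" "n 4 = 0" | "n 0 = 0" "n 4 = 0" | "n 0 = 0" "n 2 = 0"
    | "n 0 = 0" "0 < n 2" "0 < n 4" | "n 2 = 0" "0 < n 0" "0 < n 4" | "n 4 = 0" "0 < n 0" "0 < n 2"
    | "0 < n 0" "0 < n 2" "0 < n 4"
    using pos by metis
  then show ?thesis
  proof cases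
    case 1 then show ?thesis by (intro two[of 0]) auto
  next
    case 2 then show ?thesis by (intro two[of 2]) auto
  next
    case 3 then show ?thesis by (intro two[of 4]) auto
  next
    case 4
    have "n 1 + n 2 \<le> m" using C1[of 1 2 2] 4 by simp
    moreover have "n 4 + n 4 \<le> m" using C1[of 4 4 2] 4 by simp
    ultimately have False using 4 n3 S by simp
    then show ?thesis ..
  next
    case 5
    have "n 1 + n 4 \<le> m" using C1[of 1 4 0] 5 by simp
    moreover have "n 0 + n 0 \<le> m" using C1[of 0 0 0] 5 by simp
    ultimately have False using 5 n3 S by simp
    then show ?thesis ..
  next
    case 6
    have "n 1 + n 2 \<le> m" using C1[of 1 2 2] 6 by simp
    moreover have "n 0 + n 0 \<le> m" using C1[of 0 0 0] 6 by simp
    ultimately have False using 6 n3 S by simp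
    then show ?thesis ..
  next
    case 7
    have a: "n 0 + n 1 \<le> m" using C1[of 0 1 4] 7 by simp
    have b: "n 1 + n 4 \<le> m" using C1[of 1 4 0] 7 by simp
    \<comment> \<open>For \<open>5 * n 2 \<le> m\<close> the constraint \<open>C2\<close> is silent,
      but \<open>a\<close>, \<open>b\<close> and \<open>S\<close> give
      \<open>2 * n 1 < m + 2 * n 2\<close>, which suffices.\<close>
    have "3 * n 2 + 2 * n 1 \<le> 2 * m"
      using C2[of 2 1] n1 a b S n3 by (cases "m < 5 * n 2") auto
    \<comment> \<open>The hypotheses of the cubic inequality are these constraints with
      \<open>m\<close> replaced by two thirds of the total, which is larger by
      \<open>S\<close>.\<close>
    then have "0 \<le> cubic_form (n 0) (n 1) (n 2) 0 (n 4)"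
      using a b S n3 large by (intro cubic_form_nonneg_of_large_slice) simp_all
    then show ?thesis using n3 by simp
  qed
qed

text \<open>Multiplying indices by 2 preserves the solutions of \<open>i + j + k = 0\<close> modulo
  5. As 2 generates the units modulo 5, iteration gives invariance under every unit.\<close>

lemma cubic_form_rotate: "cubic_form a0 a2 a4 a1 a3 = cubic_form a0 a1 a2 a3 a4"
  unfolding cubic_form_def by (simp add: algebra_simps)

lemma slice_dichotomy:
  fixes n :: "int \<Rightarrow> real"
  assumes nonneg: "\<And>i. 0 \<le> n i"
    and C1: "\<And>i j k. i \<in> {0..<5} \<Longrightarrow> j \<in> {0..<5} \<Longrightarrow> k \<in> {0..<5} \<Longrightarrow>
      (i + j + k) mod 5 = 0 \<Longrightarrow> 0 < n k \<Longrightarrow> n i + n j \<le> m"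
    and C2: "\<And>j k. j \<in> {0..<5} \<Longrightarrow> k \<in> {0..<5} \<Longrightarrow>
      (2 * j + k) mod 5 = 0 \<Longrightarrow> 0 < n k \<Longrightarrow> m < 5 * n j \<Longrightarrow> 3 * n j + 2 * n k \<le> 2 * m"
    and S: "3 * m < 2 * (n 0 + n 1 + n 2 + n 3 + n 4)" and m: "0 \<le> m"
  shows "0 \<le> cubic_form (n 0) (n 1) (n 2) (n 3) (n 4) \<or>
    (\<exists>p\<in>{0..<5}. \<exists>q\<in>{0..<5}. p \<noteq> q \<and> (\<forall>i\<in>{0..<5} - {p, q}. n i = 0))"
proof -
  define s where "s = n 0 + n 1 + n 2 + n 3 + n 4"
  \<comment> \<open>\<open>C2\<close> with \<open>j = k = 0\<close> reads
    \<open>5 * n 0 \<le> 2 * m\<close>; this is why slice 0 obeys a sharper bound than a third of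
    the total.\<close>
  have n0: "15 * n 0 \<le> 4 * s"
    using C2[of 0 0] nonneg[of 0] S m unfolding s_def by (cases "m < 5 * n 0") auto
  have large: "?thesis" if "s < 3 * n r" "r \<in> {1,2,3,4}" for r
  proof -
    \<comment> \<open>Multiplication of the indices by the unit \<open>r\<close> moves the large
      slice to index 1 and respects both constraints.\<close>
    define n' where "n' i = n ((r * i) mod 5)" for i
    have five: "i \<in> {0,1,2,3,4}" if "i \<in> {0..<5}" for i :: int using that by auto
    have m3: "(x mod 5 + y mod 5 + z mod 5) mod 5 = (x + y + z) mod 5" for x y z :: int
    proof -
      have "(x mod 5 + y mod 5 + z mod 5) mod 5 = ((x mod 5 + y mod 5) mod 5 + z mod 5) mod 5"
        by (rule mod_add_left_eq[symmetric])
      then show ?thesis by (simp only: mod_add_eq)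
    qed
    have r5: "r * i mod 5 \<in> {0..<5}" for i by auto
    have perm: "n' 0 + n' 1 + n' 2 + n' 3 + n' 4 = s"
      "cubic_form (n' 0) (n' 1) (n' 2) (n' 3) (n' 4) = cubic_form (n 0) (n 1) (n 2) (n 3) (n 4)"
      using \<open>r \<in> {1,2,3,4}\<close> cubic_form_rotate[of "n 0" "n 1" "n 2" "n 3" "n 4"]
        cubic_form_rotate[of "n 0" "n 2" "n 4" "n 1" "n 3"] cubic_form_rotate[of "n 0" "n 4" "n 3" "n 2" "n 1"]
      unfolding s_def n'_def by auto
    have "0 \<le> cubic_form (n' 0) (n' 1) (n' 2) (n' 3) (n' 4) \<or>
      (\<exists>p\<in>{0..<5}. \<exists>q\<in>{0..<5}. p \<noteq> q \<and> (\<forall>i\<in>{0..<5} - {p, q}. n' i = 0))"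
    proof (rule slice_dichotomy_of_large_slice[where m = m])
      show "0 \<le> n' i" for i using nonneg by (simp add: n'_def)
      show "n' i + n' j \<le> m" if "(i + j + k) mod 5 = 0" "0 < n' k" for i j k
      proof -
        have "(r * i mod 5 + r * j mod 5 + r * k mod 5) mod 5 = (r * ((i + j + k) mod 5)) mod 5"
          by (simp only: m3 mod_mult_right_eq distrib_left)
        also have "\<dots> = 0" by (simp only: that(1)) simp
        finally show ?thesis using that(2) unfolding n'_def by (intro C1[OF r5 r5 r5])
      qed
      show "3 * n' j + 2 * n' k \<le> 2 * m" if "(2 * j + k) mod 5 = 0" "0 < n' k" "m < 5 * n' j" for j k
      proof -
        have "(2 * (r * j mod 5) + r * k mod 5) mod 5 = (r * ((2 * j + k) mod 5)) mod 5"
          by (simp only: mult_2 m3 mod_mult_right_eq distrib_left)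
        also have "\<dots> = 0" by (simp only: that(1)) simp
        finally show ?thesis using that(2,3) unfolding n'_def by (intro C2[OF r5 r5])
      qed
      show "3 * m < 2 * (n' 0 + n' 1 + n' 2 + n' 3 + n' 4)" using S perm(1) by (simp add: s_def)
      show "n' 0 + n' 1 + n' 2 + n' 3 + n' 4 < 3 * n' 1"
        using perm(1) that five[of r] by (auto simp: n'_def)
    qed
    moreover have ?thesis if pq: "p \<in> {0..<5}" "q \<in> {0..<5}" "p \<noteq> q" "\<forall>i\<in>{0..<5} - {p, q}. n' i = 0" for p q
    proof -
      have ne: "r * p mod 5 \<noteq> r * q mod 5"
        using five[OF pq(1)] five[OF pq(2)] \<open>r \<in> {1,2,3,4}\<close> \<open>p \<noteq> q\<close> by auto
      obtain t where t: "r * t mod 5 = 1"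
      proof -
        have "r = 1 \<or> r = 2 \<or> r = 3 \<or> r = 4" using \<open>r \<in> {1,2,3,4}\<close> by blast
        then show ?thesis using that[of 1] that[of 3] that[of 2] that[of 4] by fastforce
      qed
      have "n i = 0" if i: "i \<in> {0..<5} - {r * p mod 5, r * q mod 5}" for i
      proof -
        have "r * (t * i mod 5) mod 5 = (r * t mod 5) * i mod 5" by (simp add: mod_simps mult.assoc)
        also have "\<dots> = i" using i t by simp
        finally have ri: "r * (t * i mod 5) mod 5 = i" .
        then have "t * i mod 5 \<in> {0..<5} - {p, q}" using i by auto
        then have "n' (t * i mod 5) = 0" using pq(4) by blast
        then show ?thesis using ri by (simp add: n'_def)
      qed
      then show ?thesis using ne r5 by blast
    qed
    ultimately show ?thesis using perm(2) by metis
  qed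
  show ?thesis
  proof (cases "\<exists>r\<in>{1,2,3,4}. s < 3 * n r")
    case True
    then show ?thesis using large by blast
  next
    case False
    \<comment> \<open>Doubling the indices exchanges the pairs of slices 1, 4 and 2, 3, so the
      heavier pair may be taken to be 1, 4.\<close>
    have "0 \<le> cubic_form (n 0) (n 1) (n 2) (n 3) (n 4)"
    proof (cases "n 2 + n 3 \<le> n 1 + n 4")
      case True
      then show ?thesis using False nonneg n0 s_def
        by (intro cubic_form_nonneg_of_small_slices[where s = s]) (auto simp: not_less)
    next
      case f: False
      then have "0 \<le> cubic_form (n 0) (n 2) (n 4) (n 1) (n 3)"
        using False nonneg n0 s_def
        by (intro cubic_form_nonneg_of_small_slices[where s = s]) (auto simp: not_less)
      then show ?thesis by (simp add: cubic_form_rotate)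
    qed
    then show ?thesis ..
  qed
qed


section \<open>Sets of small doubling and epimorphisms onto the group of order five\<close>

text \<open>For \<open>d = x \<otimes> inv y\<close> in \<open>H\<close>, the translates of
  \<open>B\<close> by \<open>x\<close> and \<open>y\<close> lie in \<open>B <#> B\<close>, which is
  too small for them to overlap in only half of \<open>B\<close>. Hence more than half of the
  \<open>b\<close> in \<open>B\<close> satisfy \<open>d \<otimes> b \<in> B\<close>. Two majorities
  meet, which gives closure; counting pairs in \<open>B \<times> B\<close> by their quotient bounds
  \<open>H\<close>.\<close>

lemma (in comm_group) small_doubling_subgroup:
  assumes B: "B \<subseteq> carrier G" "finite B" "B \<noteq> {}"
    and small: "2 * card (B <#> B) < 3 * card B"
  defines "H \<equiv> {x \<otimes> inv y | x y. x \<in> B \<and> y \<in> B}"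
  shows "subgroup H G" and "card B \<le> card H" and "card H < 2 * card B"
proof -
  have carr[simp]: "x \<in> carrier G" if "x \<in> B" for x using that B by blast
  have HC: "H \<subseteq> carrier G" by (auto simp: H_def)
  have H_eq: "H = (\<lambda>(x, y). x \<otimes> inv y) ` (B \<times> B)" by (auto simp: H_def)
  have finH: "finite H" using B by (simp add: H_eq)
  have finBB: "finite (B <#> B)" using B by (auto simp: set_mult_def)
  define R where "R d = {y \<in> B. d \<otimes> y \<in> B}" for d
  have RB: "R d \<subseteq> B" "finite (R d)" for d using B by (auto simp: R_def)
  have R: "card B < 2 * card (R d)" if "d \<in> H" for d
  proof -
    obtain x y where xy: "x \<in> B" "y \<in> B" "d = x \<otimes> inv y" using \<open>d \<in> H\<close> by (auto simp: H_def)
    have inj: "inj_on (\<lambda>b. b \<otimes> z) B" if "z \<in> B" for z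
      using that by (auto simp: inj_on_def)
    let ?X = "(\<lambda>b. b \<otimes> x) ` B" and ?Y = "(\<lambda>b. b \<otimes> y) ` B"
    have "card ?X + card ?Y = card (?X \<union> ?Y) + card (?X \<inter> ?Y)"
      using B by (intro card_Un_Int) auto
    moreover have "card (?X \<union> ?Y) \<le> card (B <#> B)"
      using finBB xy by (intro card_mono) (auto simp: set_mult_def)
    moreover have "card ?X = card B" "card ?Y = card B" using inj xy by (auto simp: card_image)
    moreover have "?X \<inter> ?Y \<subseteq> (\<lambda>b. b \<otimes> x) ` R d"
    proof
      fix z assume "z \<in> ?X \<inter> ?Y"
      then obtain b b' where b: "b \<in> B" "b' \<in> B" "z = b \<otimes> x" "b \<otimes> x = b' \<otimes> y" by auto
      have "d \<otimes> b = b \<otimes> x \<otimes> inv y" unfolding xy(3) using b(1) xy(1,2) by (simp add: m_ac)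
      also have "\<dots> = b'" unfolding b(4) using b(2) xy(2) by (simp add: m_assoc)
      finally have "b \<in> R d" using b(1,2) by (simp add: R_def)
      then show "z \<in> (\<lambda>b. b \<otimes> x) ` R d" using b(3) by blast
    qed
    then have "card (?X \<inter> ?Y) \<le> card (R d)"
      using RB(2)[of d] by (meson card_image_le card_mono finite_imageI le_trans)
    ultimately show ?thesis using small by linarith
  qed
  show "subgroup H G"
  proof (rule subgroupI)
    show "H \<subseteq> carrier G" by (rule HC)
    show "H \<noteq> {}" using B by (auto simp: H_def)
    show "inv d \<in> H" if "d \<in> H" for d
    proof -
      obtain x y where "x \<in> B" "y \<in> B" "d = x \<otimes> inv y" using \<open>d \<in> H\<close> by (auto simp: H_def)
      moreover then have "inv d = y \<otimes> inv x" by (simp add: inv_mult_group)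
      ultimately show ?thesis by (auto simp: H_def)
    qed
    show "d \<otimes> e \<in> H" if "d \<in> H" "e \<in> H" for d e
    proof -
      have [simp]: "d \<in> carrier G" "e \<in> carrier G" using that HC by auto
      \<comment> \<open>\<open>?Z\<close> and \<open>R d\<close> are both majorities of
        \<open>B\<close>; a common element \<open>e \<otimes> y\<close> exhibits
        \<open>d \<otimes> e\<close> as a quotient of elements of \<open>B\<close>.\<close>
      let ?Z = "(\<lambda>y. e \<otimes> y) ` R e"
      have Z: "?Z \<subseteq> B" by (auto simp: R_def)
      have "inj_on (\<lambda>y. e \<otimes> y) (R e)" by (auto simp: inj_on_def R_def)
      then have "card ?Z = card (R e)" by (rule card_image)
      moreover have "card (?Z \<union> R d) \<le> card B" using Z RB B by (intro card_mono) auto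
      ultimately have "?Z \<inter> R d \<noteq> {}"
        using R[OF \<open>d \<in> H\<close>] R[OF \<open>e \<in> H\<close>] card_Un_disjoint[of ?Z "R d"] RB by fastforce
      then obtain y where y: "y \<in> B" "e \<otimes> y \<in> B" "d \<otimes> (e \<otimes> y) \<in> B" by (auto simp: R_def)
      have "d \<otimes> e = (d \<otimes> (e \<otimes> y)) \<otimes> inv y" using y(1) by (simp add: m_assoc)
      then show ?thesis using y unfolding H_def by blast
    qed
  qed
  show "card B \<le> card H"
  proof -
    obtain b where "b \<in> B" using B by auto
    then show ?thesis using finH
      by (intro card_inj_on_le[of "\<lambda>x. x \<otimes> inv b"]) (auto simp: inj_on_def H_def)
  qed
  show "card H < 2 * card B"
  proof (rule ccontr)
    assume "\<not> ?thesis"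
    then have le: "2 * card B \<le> card H" by simp
    have "card (Sigma H R) \<le> card (B \<times> B)"
    proof (rule card_inj_on_le[of "\<lambda>(d, y). (d \<otimes> y, y)"])
      show "inj_on (\<lambda>(d, y). (d \<otimes> y, y)) (Sigma H R)"
        using HC by (auto simp: inj_on_def R_def subset_iff)
    qed (use B in \<open>auto simp: R_def\<close>)
    moreover have "card (Sigma H R) = (\<Sum>d\<in>H. card (R d))" using finH RB by simp
    ultimately have "(\<Sum>d\<in>H. 2 * card (R d)) \<le> 2 * (card B * card B)"
      by (simp add: card_cartesian_product flip: sum_distrib_left)
    \<comment> \<open>The extra 1 records that the majorities are strict; it makes the count
      contradict \<open>2 * card B \<le> card H\<close>.\<close>
    moreover have "(\<Sum>d\<in>H. card B + 1) \<le> (\<Sum>d\<in>H. 2 * card (R d))"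
      using R by (intro sum_mono) force
    ultimately have "card H * (card B + 1) \<le> 2 * card B * card B" by simp
    moreover have "2 * card B * (card B + 1) \<le> card H * (card B + 1)" using le by (rule mult_right_mono) simp
    moreover have "0 < card B" using B by (simp add: card_gt_0_iff)
    ultimately show False by simp
  qed
qed

section \<open>Epimorphisms onto the group of order five and their fibers\<close>

locale Z5_epi = comm_group G for G (structure) +
  fixes \<phi> :: "'a \<Rightarrow> int"
  assumes phi_hom: "\<phi> \<in> hom G (integer_mod_group 5)"
    and finite_carrier: "finite (carrier G)"
    and nontrivial: "\<exists>x\<in>carrier G. \<phi> x \<noteq> 0"
begin

definition fiber :: "int \<Rightarrow> 'a set"
  where "fiber i = {x \<in> carrier G. \<phi> x = i}"

lemma phi_range: "x \<in> carrier G \<Longrightarrow> \<phi> x \<in> {0..<5}"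
  using phi_hom by (auto simp: hom_def Pi_iff carrier_integer_mod_group)

lemma phi_mult [simp]:
  "x \<in> carrier G \<Longrightarrow> y \<in> carrier G \<Longrightarrow> \<phi> (x \<otimes> y) = (\<phi> x + \<phi> y) mod 5"
  using phi_hom by (auto simp: hom_def)

lemma phi_mod [simp]: "x \<in> carrier G \<Longrightarrow> \<phi> x mod 5 = \<phi> x"
  using phi_range[of x] by simp

lemma phi_one [simp]: "\<phi> \<one> = 0"
  using phi_mult[of \<one> \<one>] phi_range[of \<one>] by auto presburger

lemma phi_inv [simp]: "x \<in> carrier G \<Longrightarrow> \<phi> (inv x) = (- \<phi> x) mod 5"
  using phi_mult[of x "inv x"] phi_range[of x] phi_range[of "inv x"] by simp presburger

lemma phi_surj: 
  assumes "i \<in> {0..<5}"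
  obtains x where "x \<in> carrier G" "\<phi> x = i"
proof -
  obtain g where g: "g \<in> carrier G" "\<phi> g \<noteq> 0" using nontrivial by blast
  have pw: "\<phi> (g [^] k) = (int k * \<phi> g) mod 5" for k :: nat
    using g by (induction k) (simp_all add: mod_simps algebra_simps)
  \<comment> \<open>As 5 is prime, the multiples of a nonzero residue exhaust all residues, so
    nontriviality already gives surjectivity.\<close>
  have "\<phi> g \<in> {1,2,3,4}" using phi_range[OF g(1)] g(2) by auto
  moreover have "i \<in> {0,1,2,3,4}" using assms by auto
  ultimately have "\<exists>k\<in>{0,1,2,3,4::nat}. (int k * \<phi> g) mod 5 = i"
    by auto
  then show ?thesis using pw g that by (metis nat_pow_closed)
qed

lemma card_fiber:
  assumes "i \<in> {0..<5}"
  shows "5 * card (fiber i) = order G"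
proof -
  have eq: "card (fiber j) = card (fiber 0)" if j: "j \<in> {0..<5}" for j
  proof -
    obtain g where g: "g \<in> carrier G" "\<phi> g = j" using phi_surj[OF j] .
    have "bij_betw (\<lambda>x. x \<otimes> g) (fiber 0) (fiber j)"
    proof (rule bij_betw_byWitness[where f' = "\<lambda>x. x \<otimes> inv g"])
      show "(\<lambda>x. x \<otimes> g) ` fiber 0 \<subseteq> fiber j" using g j by (auto simp: fiber_def)
      show "(\<lambda>x. x \<otimes> inv g) ` fiber j \<subseteq> fiber 0" using g j by (auto simp: fiber_def mod_simps)
    qed (use g in \<open>auto simp: fiber_def m_assoc\<close>)
    then show ?thesis by (simp add: bij_betw_same_card)
  qed
  have "carrier G = (\<Union>j\<in>{0..<5}. fiber j)" using phi_range by (auto simp: fiber_def)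
  then have "order G = (\<Sum>j\<in>{0..<5}. card (fiber j))"
    unfolding order_def using finite_carrier
    by (simp only:) (rule card_UN_disjoint, auto simp: fiber_def)
  also have "\<dots> = (\<Sum>j\<in>{0..<5::int}. card (fiber 0))" by (intro sum.cong refl eq)
  finally show ?thesis using eq[OF assms] by simp
qed

lemma subgroup_fiber_0: "subgroup (fiber 0) G"
  by (rule subgroupI) (auto simp: fiber_def mod_simps)

lemma fiber_in_rcosets:
  assumes "i \<in> {0..<5}"
  shows "fiber i \<in> rcosets (fiber 0)"
proof -
  obtain g where g: "g \<in> carrier G" "\<phi> g = i" using phi_surj[OF assms] .
  have "fiber i = fiber 0 #> g"
  proof (intro equalityI subsetI)
    fix x assume "x \<in> fiber i"
    then have "x \<otimes> inv g \<in> fiber 0" "x = (x \<otimes> inv g) \<otimes> g"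
      using g by (auto simp: fiber_def mod_simps m_assoc)
    then show "x \<in> fiber 0 #> g" by (auto simp: r_coset_def)
  qed (use g assms in \<open>auto simp: fiber_def r_coset_def\<close>)
  then show ?thesis using g by (auto simp: RCOSETS_def)
qed

lemma card_rcosets_fiber_0: "card (rcosets (fiber 0)) = 5"
proof -
  have "card (rcosets (fiber 0)) * card (fiber 0) = 5 * card (fiber 0)"
    using lagrange[OF subgroup_fiber_0] card_fiber[of 0] by simp
  moreover have "card (fiber 0) \<noteq> 0"
    using subgroup.one_closed[OF subgroup_fiber_0] finite_carrier by (auto simp: fiber_def)
  ultimately show ?thesis by simp
qed

end


section \<open>Slices of a set\<close>

abbreviation slice :: "('a \<Rightarrow> int) \<Rightarrow> 'a set \<Rightarrow> int \<Rightarrow> 'a set"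
  where "slice \<phi> A i \<equiv> {a \<in> A. \<phi> a = i}"

text \<open>As indicator sums over \<open>A\<close>, the cubic can be summed over all characters at
  once. The proof collapses one summation variable at a time to five terms weighted by slice
  sizes.\<close>

lemma cubic_form_slices:
  fixes \<phi> :: "'a \<Rightarrow> int"
  assumes "finite A" "\<phi> ` A \<subseteq> {0..<5}"
  shows "cubic_form (card (slice \<phi> A 0)) (card (slice \<phi> A 1)) (card (slice \<phi> A 2))
      (card (slice \<phi> A 3)) (card (slice \<phi> A 4)) =
    7 * (\<Sum>a\<in>A. \<Sum>b\<in>A. \<Sum>c\<in>A. of_bool ((\<phi> a + \<phi> b + \<phi> c) mod 5 = 0)) +
    3 * real (card A) * (\<Sum>a\<in>A. \<Sum>b\<in>A. of_bool (\<phi> a = \<phi> b)) - 2 * real (card A) ^ 3"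
proof -
  define N where "N i = real (card (slice \<phi> A i))" for i
  have five: "{0..<5::int} = {0,1,2,3,4}" by auto
  have sum_slices: "(\<Sum>a\<in>A. h (\<phi> a)) = N 0 * h 0 + N 1 * h 1 + N 2 * h 2 + N 3 * h 3 + N 4 * h 4"
    for h :: "int \<Rightarrow> real"
  proof -
    have "(\<Sum>a\<in>A. h (\<phi> a)) = (\<Sum>i\<in>{0..<5}. \<Sum>a\<in>slice \<phi> A i. h (\<phi> a))"
      using sum.group[OF assms(1) _ assms(2), of "\<lambda>a. h (\<phi> a)"] by simp
    also have "\<dots> = (\<Sum>i\<in>{0..<5}. N i * h i)"
      by (intro sum.cong) (auto simp: N_def)
    finally show ?thesis by (simp add: five)
  qed
  have "real (card A) = N 0 + N 1 + N 2 + N 3 + N 4"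
    using sum_slices[of "\<lambda>_. 1"] by simp
  moreover have "(\<Sum>a\<in>A. \<Sum>b\<in>A. of_bool (\<phi> a = \<phi> b) :: real) =
      N 0 ^ 2 + N 1 ^ 2 + N 2 ^ 2 + N 3 ^ 2 + N 4 ^ 2"
    by (simp add: sum_slices[of "\<lambda>j. of_bool (_ = j)"]
        sum_slices[of "\<lambda>i. N 0 * of_bool (i = 0) + N 1 * of_bool (i = 1) + N 2 * of_bool (i = 2)
          + N 3 * of_bool (i = 3) + N 4 * of_bool (i = 4)"] power2_eq_square)
  moreover have "(\<Sum>a\<in>A. \<Sum>b\<in>A. \<Sum>c\<in>A. of_bool ((\<phi> a + \<phi> b + \<phi> c) mod 5 = 0) :: real) =
      N 0 ^ 3 + 6 * N 0 * (N 1 * N 4 + N 2 * N 3) +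
      3 * (N 1 ^ 2 * N 3 + N 2 ^ 2 * N 1 + N 3 ^ 2 * N 4 + N 4 ^ 2 * N 2)"
  proof -
    define f where "f i j = N 0 * of_bool ((i + j + 0) mod 5 = 0) + N 1 * of_bool ((i + j + 1) mod 5 = 0)
      + N 2 * of_bool ((i + j + 2) mod 5 = 0) + N 3 * of_bool ((i + j + 3) mod 5 = 0)
      + N 4 * of_bool ((i + j + 4) mod 5 = 0)" for i j :: int
    define g where "g i = N 0 * f i 0 + N 1 * f i 1 + N 2 * f i 2 + N 3 * f i 3 + N 4 * f i 4" for i
    have "(\<Sum>c\<in>A. of_bool ((i + j + \<phi> c) mod 5 = 0)) = f i j" for i j
      unfolding f_def by (rule sum_slices)
    moreover have "(\<Sum>b\<in>A. f i (\<phi> b)) = g i" for i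
      unfolding g_def by (rule sum_slices)
    ultimately have "(\<Sum>a\<in>A. \<Sum>b\<in>A. \<Sum>c\<in>A. of_bool ((\<phi> a + \<phi> b + \<phi> c) mod 5 = 0)) =
        N 0 * g 0 + N 1 * g 1 + N 2 * g 2 + N 3 * g 3 + N 4 * g 4"
      using sum_slices[of g] by simp
    also have "\<dots> = N 0 ^ 3 + 6 * N 0 * (N 1 * N 4 + N 2 * N 3) +
        3 * (N 1 ^ 2 * N 3 + N 2 ^ 2 * N 1 + N 3 ^ 2 * N 4 + N 4 ^ 2 * N 2)"
      by (simp add: g_def f_def power2_eq_square power3_eq_cube algebra_simps)
    finally show ?thesis .
  qed
  ultimately show ?thesis by (simp only: cubic_form_def N_def)
qed

section \<open>Size constraints on the slices of a set without solutions of
  \<open>x \<otimes> y \<otimes> z = \<one>\<close>\<close>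

lemma dvd_power_5_ge:
  fixes k :: nat
  assumes "k dvd 5 ^ n" "k \<noteq> 1"
  shows "5 \<le> k"
proof (rule ccontr)
  assume "\<not> 5 \<le> k"
  moreover have "k \<noteq> 0" using assms(1) by (cases "k = 0") auto
  ultimately have "k \<in> {2, 3, 4}" using assms(2) by auto
  then have "coprime k 5" by (auto simp: coprime_iff_gcd_eq_1 gcd_non_0_nat)
  then have "coprime k (5 ^ n)" by simp
  then show False using assms coprime_common_divisor[of k "5 ^ n" k] by simp
qed

context Z5_epi
begin

lemma slice_subset_fiber: "A \<subseteq> carrier G \<Longrightarrow> slice \<phi> A i \<subseteq> fiber i"
  by (auto simp: fiber_def)

lemma finite_fiber: "finite (fiber i)"
  using finite_carrier by (simp add: fiber_def)

lemma card_fiber_eq: "i \<in> {0..<5} \<Longrightarrow> card (fiber i) = card (fiber 0)"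
  using card_fiber[of i] card_fiber[of 0] by simp

text \<open>Fix \<open>c\<close> in slice \<open>k\<close>. The injection
  \<open>x \<mapsto> inv (x \<otimes> c)\<close> sends slice \<open>j\<close> into the fiber over
  \<open>i\<close> but outside \<open>A\<close>, so its image and slice \<open>i\<close> fit
  disjointly into one fiber.\<close>

lemma card_slice_add_le:
  assumes A: "A \<subseteq> carrier G" and free: "\<And>x y z. x \<in> A \<Longrightarrow> y \<in> A \<Longrightarrow> z \<in> A \<Longrightarrow> x \<otimes> y \<otimes> z \<noteq> \<one>"
    and i: "i \<in> {0..<5}" and s: "(i + j + k) mod 5 = 0" and k: "slice \<phi> A k \<noteq> {}"
  shows "card (slice \<phi> A i) + card (slice \<phi> A j) \<le> card (fiber 0)"
proof -
  obtain c where c: "c \<in> A" "\<phi> c = k" using k by auto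
  have carr: "x \<in> carrier G" if "x \<in> A" for x using A that by auto
  let ?f = "\<lambda>x. inv (x \<otimes> c)"
  have f: "?f ` slice \<phi> A j \<subseteq> fiber i"
  proof clarify
    fix x assume x: "x \<in> A" "j = \<phi> x"
    have "(- ((\<phi> x + \<phi> c) mod 5)) mod 5 = i" using i s c x by simp presburger
    then show "?f x \<in> fiber i" using carr x c by (auto simp: fiber_def)
  qed
  have "slice \<phi> A i \<inter> ?f ` slice \<phi> A j = {}"
  proof -
    have "?f x \<notin> A" if "x \<in> A" for x
      using free[OF _ that c(1), of "?f x"] carr that c by (auto simp: m_assoc)
    then show ?thesis by blast
  qed
  moreover have "inj_on ?f (slice \<phi> A j)"
  proof (rule inj_onI)
    fix x y assume "x \<in> slice \<phi> A j" "y \<in> slice \<phi> A j" and eq: "?f x = ?f y"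
    then have "x \<in> carrier G" "y \<in> carrier G" "c \<in> carrier G" using carr c by auto
    with eq show "x = y" by (metis inv_inv m_closed right_cancel)
  qed
  ultimately have "card (slice \<phi> A i) + card (slice \<phi> A j) = card (slice \<phi> A i \<union> ?f ` slice \<phi> A j)"
    using finite_subset[OF A finite_carrier] by (simp add: card_Un_disjoint card_image)
  also have "\<dots> \<le> card (fiber i)"
    using f slice_subset_fiber[OF A] finite_fiber by (intro card_mono) auto
  finally show ?thesis using card_fiber_eq[OF i] by simp
qed

text \<open>With \<open>B\<close>, \<open>C\<close> the slices \<open>j\<close>, \<open>k\<close>,
  the sets \<open>B <#> B\<close> and the inverses of \<open>C\<close> are disjoint in one fiber. It
  remains to see \<open>3|B| \<le> 2|B <#> B|\<close>: otherwise \<open>B\<close> is no larger than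
  a proper subgroup of the kernel, whose index is at least 5, against the lower bound on
  \<open>B\<close>.\<close>

lemma card_slice_double_le:
  assumes ord: "order G = 5 ^ n"
    and A: "A \<subseteq> carrier G" and free: "\<And>x y z. x \<in> A \<Longrightarrow> y \<in> A \<Longrightarrow> z \<in> A \<Longrightarrow> x \<otimes> y \<otimes> z \<noteq> \<one>"
    and j: "j \<in> {0..<5}" and s: "(2 * j + k) mod 5 = 0" and k: "slice \<phi> A k \<noteq> {}"
    and large: "card (fiber 0) < 5 * card (slice \<phi> A j)"
  shows "3 * card (slice \<phi> A j) + 2 * card (slice \<phi> A k) \<le> 2 * card (fiber 0)"
proof -
  let ?B = "slice \<phi> A j" and ?C = "slice \<phi> A k"
  have carr: "x \<in> carrier G" if "x \<in> A" for x using A that by auto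
  have fin: "finite ?B" "finite ?C" using A finite_carrier by (auto intro: finite_subset)
  have BB: "?B <#> ?B \<subseteq> fiber (2 * j mod 5)"
  proof
    fix z assume "z \<in> ?B <#> ?B"
    then obtain x y where xy: "x \<in> A" "y \<in> A" "\<phi> x = j" "\<phi> y = j" "z = x \<otimes> y"
      unfolding set_mult_def by blast
    then have "\<phi> z = 2 * j mod 5" using phi_mult[of x y] carr by (simp only: mult_2)
    then show "z \<in> fiber (2 * j mod 5)" using xy carr by (simp only: fiber_def mem_Collect_eq m_closed)
  qed
  have C: "m_inv G ` ?C \<subseteq> fiber (2 * j mod 5)"
  proof clarify
    fix x assume x: "x \<in> A" "k = \<phi> x"
    have "(- \<phi> x) mod 5 = 2 * j mod 5" using s x by presburger
    then show "inv x \<in> fiber (2 * j mod 5)" using carr x by (auto simp: fiber_def)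
  qed
  have "(?B <#> ?B) \<inter> m_inv G ` ?C = {}"
  proof -
    have "x \<otimes> y \<noteq> inv z" if "x \<in> A" "y \<in> A" "z \<in> A" for x y z
      using free[OF that] carr that by auto
    then show ?thesis unfolding set_mult_def by blast
  qed
  moreover have "card (m_inv G ` ?C) = card ?C"
    using carr by (intro card_image inj_onI) (metis (lifting) inv_inv mem_Collect_eq)
  ultimately have "card (?B <#> ?B) + card ?C = card ((?B <#> ?B) \<union> m_inv G ` ?C)"
    using fin finite_subset[OF BB finite_fiber] by (subst card_Un_disjoint) auto
  also have "\<dots> \<le> card (fiber (2 * j mod 5))"
    using BB C finite_fiber by (intro card_mono) auto
  also have "\<dots> = card (fiber 0)" by (rule card_fiber_eq) simp
  finally have sum_le: "card (?B <#> ?B) + card ?C \<le> card (fiber 0)" .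
  have "3 * card ?B \<le> 2 * card (?B <#> ?B)"
  proof (rule ccontr)
    assume "\<not> ?thesis"
    then have small: "2 * card (?B <#> ?B) < 3 * card ?B" by simp
    define H where "H = {x \<otimes> inv y | x y. x \<in> ?B \<and> y \<in> ?B}"
    have ne: "?B \<noteq> {}"
    proof
      assume "?B = {}"
      then show False using large by (simp only: card.empty)
    qed
    have H: "subgroup H G" "card ?B \<le> card H" "card H < 2 * card ?B"
      using small_doubling_subgroup[of ?B] carr fin ne small unfolding H_def by auto
    have HF: "H \<subseteq> fiber 0"
      using carr by (auto simp: H_def fiber_def mod_simps)
    \<comment> \<open>The pigeonhole bound with \<open>i = j\<close>; together with
      \<open>card H < 2 * card ?B\<close> it makes \<open>H\<close> a proper subgroup of the
      kernel.\<close>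
    have "2 * card ?B \<le> card (fiber 0)"
    proof -
      have "(j + j + k) mod 5 = 0" using s by (simp only: mult_2)
      then show ?thesis using card_slice_add_le[OF A free j _ k] by (simp only: mult_2)
    qed
    with H have less: "card H < card (fiber 0)" by linarith
    have "subgroup H (G\<lparr>carrier := fiber 0\<rparr>)"
      using subgroup_incl[OF H(1) subgroup_fiber_0 HF] .
    from group.lagrange[OF subgroup_imp_group[OF subgroup_fiber_0] this]
    obtain K where K: "K * card H = card (fiber 0)" by (auto simp: order_def)
    have "5 * (K * card H) = 5 ^ n" using card_fiber[of 0] ord K by simp
    then have "K dvd 5 ^ n" by (metis dvd_triv_left dvd_mult)
    moreover have "K \<noteq> 1" using K less by auto
    ultimately have "5 \<le> K" by (rule dvd_power_5_ge)
    then have "5 * card H \<le> K * card H" by (rule mult_right_mono) simp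
    then have "5 * card H \<le> card (fiber 0)" using K by simp
    then show False using large H by linarith
  qed
  then show ?thesis using sum_le by linarith
qed

lemma cubic_form_nonneg_or_two_fibers:
  assumes ord: "order G = 5 ^ n"
    and A: "A \<subseteq> carrier G" and free: "\<And>x y z. x \<in> A \<Longrightarrow> y \<in> A \<Longrightarrow> z \<in> A \<Longrightarrow> x \<otimes> y \<otimes> z \<noteq> \<one>"
    and large: "3 * card (fiber 0) < 2 * card A"
  shows "0 \<le> cubic_form (card (slice \<phi> A 0)) (card (slice \<phi> A 1)) (card (slice \<phi> A 2))
      (card (slice \<phi> A 3)) (card (slice \<phi> A 4)) \<or>
    (\<exists>p\<in>{0..<5}. \<exists>q\<in>{0..<5}. p \<noteq> q \<and> A \<subseteq> fiber p \<union> fiber q)"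
proof -
  define N where "N i = real (card (slice \<phi> A i))" for i
  have fin: "finite A" using A finite_carrier by (rule finite_subset)
  have zero: "N i = 0 \<longleftrightarrow> slice \<phi> A i = {}" for i using fin by (simp add: N_def)
  have "real (card A) = (\<Sum>i\<in>{0..<5}. N i)"
  proof -
    have "card A = (\<Sum>i\<in>{0..<5}. \<Sum>a\<in>slice \<phi> A i. 1)"
    proof (subst sum.group)
      show "\<phi> ` A \<subseteq> {0..<5}" using A phi_range by (simp only: image_subset_iff) blast
    qed (use fin in auto)
    then show ?thesis by (simp add: N_def)
  qed
  moreover have "{0..<5::int} = {0,1,2,3,4}" by auto
  ultimately have S: "real (card A) = N 0 + N 1 + N 2 + N 3 + N 4" by simp
  have "0 \<le> cubic_form (N 0) (N 1) (N 2) (N 3) (N 4) \<or>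
    (\<exists>p\<in>{0..<5}. \<exists>q\<in>{0..<5}. p \<noteq> q \<and> (\<forall>i\<in>{0..<5} - {p, q}. N i = 0))"
  proof (rule slice_dichotomy[where m = "card (fiber 0)"])
    show "N i + N j \<le> card (fiber 0)"
      if "i \<in> {0..<5}" "j \<in> {0..<5}" "k \<in> {0..<5}" "(i + j + k) mod 5 = 0" "0 < N k" for i j k
      using card_slice_add_le[OF A free that(1,4)] that(5) zero[of k] by (simp add: N_def)
    show "3 * N j + 2 * N k \<le> 2 * real (card (fiber 0))"
      if "j \<in> {0..<5}" "k \<in> {0..<5}" "(2 * j + k) mod 5 = 0" "0 < N k" "card (fiber 0) < 5 * N j" for j k
      using card_slice_double_le[OF ord A free that(1,3)] that(4,5) zero[of k]
      unfolding N_def by fastforce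
    show "3 * real (card (fiber 0)) < 2 * (N 0 + N 1 + N 2 + N 3 + N 4)"
    proof -
      have "real (3 * card (fiber 0)) < real (2 * card A)" using large by (simp only: of_nat_less_iff)
      then show ?thesis using S by simp
    qed
  qed (auto simp: N_def)
  moreover have "A \<subseteq> fiber p \<union> fiber q" if "\<forall>i\<in>{0..<5} - {p, q}. N i = 0" for p q
  proof
    fix x assume x: "x \<in> A"
    then have "N (\<phi> x) \<noteq> 0" using zero by blast
    moreover have "\<phi> x \<in> {0..<5}" using x A phi_range by blast
    ultimately have "\<phi> x \<in> {p, q}" using that by blast
    then show "x \<in> fiber p \<union> fiber q" using x A by (auto simp: fiber_def)
  qed
  ultimately show ?thesis unfolding N_def by meson
qed

end


section \<open>Averaging over the characters\<close>

lemma (in comm_group) fold_sumset_3: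
  assumes "A \<subseteq> carrier G"
  shows "fold_sumset G 3 A = {x \<otimes> y \<otimes> z | x y z. x \<in> A \<and> y \<in> A \<and> z \<in> A}"
proof -
  have three: "{1..3::nat} = {1, 2, 3}" by auto
  have prod: "finprod G a {1, 2, 3::nat} = a 1 \<otimes> a 2 \<otimes> a 3"
    if "a 1 \<in> A" "a 2 \<in> A" "a 3 \<in> A" for a
  proof -
    have "a 1 \<in> carrier G" "a 2 \<in> carrier G" "a 3 \<in> carrier G" using that assms by auto
    then show ?thesis by (simp add: m_assoc)
  qed
  show ?thesis
  proof (intro equalityI subsetI)
    fix w assume "w \<in> fold_sumset G 3 A"
    then obtain a where "a \<in> {1, 2, 3::nat} \<rightarrow> A" "w = finprod G a {1, 2, 3}"
      unfolding fold_sumset_def three by blast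
    then show "w \<in> {x \<otimes> y \<otimes> z | x y z. x \<in> A \<and> y \<in> A \<and> z \<in> A}"
      using prod[of a] by auto
  next
    fix w assume "w \<in> {x \<otimes> y \<otimes> z | x y z. x \<in> A \<and> y \<in> A \<and> z \<in> A}"
    then obtain x y z where w: "x \<in> A" "y \<in> A" "z \<in> A" "w = x \<otimes> y \<otimes> z" by blast
    define a where "a i = (if i = 1 then x else if i = 2 then y else z)" for i :: nat
    have "w = finprod G a {1, 2, 3}" "a \<in> {1, 2, 3} \<rightarrow> A"
      using w prod[of a] by (auto simp: a_def)
    then show "w \<in> fold_sumset G 3 A" unfolding fold_sumset_def three by blast
  qed
qed

section \<open>The characters \<open>dot n u\<close> of \<open>Z5_power n\<close>, with values in
  Z_5, and their averages\<close>

definition dot :: "nat \<Rightarrow> (nat \<Rightarrow> int) \<Rightarrow> (nat \<Rightarrow> int) \<Rightarrow> int"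
  where "dot n u x = (\<Sum>i<n. u i * x i) mod 5"

lemma carrier_Z5_power: "carrier (Z5_power n) = {..<n} \<rightarrow>\<^sub>E {0..<5}"
  by (simp add: Z5_power_def carrier_integer_mod_group)

lemma mult_Z5_power: "x \<otimes>\<^bsub>Z5_power n\<^esub> y = (\<lambda>i\<in>{..<n}. (x i + y i) mod 5)"
  by (simp add: Z5_power_def)

lemma one_Z5_power: "\<one>\<^bsub>Z5_power n\<^esub> = (\<lambda>i\<in>{..<n}. 0)"
  by (simp add: Z5_power_def)

lemma finite_carrier_Z5_power: "finite (carrier (Z5_power n))"
  by (simp add: carrier_Z5_power finite_PiE)

lemma card_carrier_Z5_power: "card (carrier (Z5_power n)) = 5 ^ n"
  using order_Z5_power[of n] by (simp add: order_def)

lemma dot_commute: "dot n u x = dot n x u"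
  by (simp add: dot_def mult.commute)

lemma dot_nonneg: "0 \<le> dot n u x" and dot_less: "dot n u x < 5"
  by (simp_all add: dot_def)

lemma dot_one: "dot n \<one>\<^bsub>Z5_power n\<^esub> x = 0"
  by (simp add: dot_def one_Z5_power)

lemma dot_mult: "dot n u (x \<otimes>\<^bsub>Z5_power n\<^esub> y) = (dot n u x + dot n u y) mod 5"
proof -
  have "dot n u (x \<otimes>\<^bsub>Z5_power n\<^esub> y) = (\<Sum>i<n. u i * ((x i + y i) mod 5)) mod 5"
    by (simp add: dot_def mult_Z5_power)
  also have "\<dots> = (\<Sum>i<n. u i * ((x i + y i) mod 5) mod 5) mod 5"
    by (simp only: mod_sum_eq)
  also have "\<dots> = (\<Sum>i<n. u i * (x i + y i) mod 5) mod 5"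
    by (simp only: mod_mult_right_eq)
  also have "\<dots> = (\<Sum>i<n. u i * (x i + y i)) mod 5"
    by (simp only: mod_sum_eq)
  also have "\<dots> = (dot n u x + dot n u y) mod 5"
    by (simp add: dot_def mod_add_eq distrib_left sum.distrib)
  finally show ?thesis .
qed

lemma Z5_epi_dot:
  assumes "u \<in> carrier (Z5_power n)" "u \<noteq> \<one>\<^bsub>Z5_power n\<^esub>"
  shows "Z5_epi (Z5_power n) (dot n u)"
proof -
  interpret comm_group "Z5_power n" by (rule comm_group_Z5_power)
  obtain i where i: "i < n" "u i \<noteq> 0"
    using assms PiE_ext[of u "{..<n}" "\<lambda>_. {0..<5}" "\<one>\<^bsub>Z5_power n\<^esub>"]
    by (auto simp: carrier_Z5_power one_Z5_power)
  \<comment> \<open>A unit vector at a coordinate where \<open>u\<close> is nonzero, so that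
    \<open>dot n u x\<close> is \<open>u i\<close>.\<close>
  define x where "x = (\<lambda>j\<in>{..<n}. if j = i then 1 else 0 :: int)"
  have "u i \<in> {0..<5}" using assms i by (auto simp: carrier_Z5_power PiE_iff)
  moreover have "(\<Sum>j<n. u j * x j) = u i"
  proof -
    have "(\<Sum>j<n. u j * x j) = (\<Sum>j<n. if j = i then u j else 0)"
      by (intro sum.cong) (auto simp: x_def)
    then show ?thesis using i by simp
  qed
  ultimately have "dot n u x \<noteq> 0" using i by (simp add: dot_def)
  moreover have "x \<in> carrier (Z5_power n)" by (auto simp: carrier_Z5_power x_def)
  ultimately show ?thesis
    by unfold_locales
      (auto simp: hom_def dot_mult dot_nonneg dot_less carrier_integer_mod_group finite_carrier_Z5_power)
qed

text \<open>By symmetry of \<open>dot\<close>, the annihilator of \<open>x\<close> is the kernel of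
  the nontrivial character attached to \<open>x\<close>.\<close>

lemma card_annihilator:
  assumes "x \<in> carrier (Z5_power n)" "x \<noteq> \<one>\<^bsub>Z5_power n\<^esub>"
  shows "5 * card {u \<in> carrier (Z5_power n). dot n u x = 0} = 5 ^ n"
proof -
  interpret Z5_epi "Z5_power n" "dot n x" using Z5_epi_dot[OF assms] .
  show ?thesis using card_fiber[of 0] order_Z5_power by (simp add: fiber_def dot_commute)
qed

lemma sum_dot_eq_0:
  assumes "x \<in> carrier (Z5_power n)"
  shows "(\<Sum>u\<in>carrier (Z5_power n). of_bool (dot n u x = 0) :: real) =
    5 ^ n / 5 + 4 * 5 ^ n / 5 * of_bool (x = \<one>\<^bsub>Z5_power n\<^esub>)"
proof -
  have *: "(\<Sum>u\<in>carrier (Z5_power n). of_bool (dot n u x = 0) :: real) =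
      card {u \<in> carrier (Z5_power n). dot n u x = 0}"
    using finite_carrier_Z5_power[of n] by (simp add: Collect_conj_eq)
  show ?thesis
  proof (cases "x = \<one>\<^bsub>Z5_power n\<^esub>")
    case True
    then have "{u \<in> carrier (Z5_power n). dot n u x = 0} = carrier (Z5_power n)"
      using dot_one dot_commute by auto
    then show ?thesis using * True card_carrier_Z5_power[of n] by simp
  next
    case False
    have "real (5 * card {u \<in> carrier (Z5_power n). dot n u x = 0}) = 5 ^ n"
      using card_annihilator[OF assms False] by simp
    then show ?thesis using * False by simp
  qed
qed

text \<open>With \<open>m = 5^(n-1)\<close>: no triple product is trivial, so each triple is counted
  by exactly \<open>m\<close> characters and \<open>T\<close> sums to \<open>m S^3\<close>. Pairs
  give \<open>Q\<close> the sum \<open>m S^2 + 4 m S\<close>, the excess coming from the diagonal.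
  The weights 7, 3, -2 cancel the terms in \<open>S^3\<close>, as
  \<open>7 + 3 - 5 * 2 = 0\<close>.\<close>

lemma sum_cubic_form:
  assumes A: "A \<subseteq> carrier (Z5_power n)"
    and free: "\<And>x y z. x \<in> A \<Longrightarrow> y \<in> A \<Longrightarrow> z \<in> A \<Longrightarrow>
      x \<otimes>\<^bsub>Z5_power n\<^esub> y \<otimes>\<^bsub>Z5_power n\<^esub> z \<noteq> \<one>\<^bsub>Z5_power n\<^esub>"
  shows "(\<Sum>u\<in>carrier (Z5_power n). cubic_form (card (slice (dot n u) A 0))
      (card (slice (dot n u) A 1)) (card (slice (dot n u) A 2))
      (card (slice (dot n u) A 3)) (card (slice (dot n u) A 4))) =
    12 * 5 ^ n / 5 * real (card A) ^ 2"
proof -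
  interpret comm_group "Z5_power n" by (rule comm_group_Z5_power)
  let ?C = "carrier (Z5_power n)" and ?S = "real (card A)"
  have fin: "finite A" using A finite_carrier_Z5_power by (rule finite_subset)
  have carr: "x \<in> ?C" if "x \<in> A" for x using A that by auto
  have "(\<Sum>u\<in>?C. \<Sum>a\<in>A. \<Sum>b\<in>A. \<Sum>c\<in>A. of_bool ((dot n u a + dot n u b + dot n u c) mod 5 = 0) :: real) =
      (\<Sum>a\<in>A. \<Sum>b\<in>A. \<Sum>c\<in>A. \<Sum>u\<in>?C. of_bool (dot n u (a \<otimes>\<^bsub>Z5_power n\<^esub> b \<otimes>\<^bsub>Z5_power n\<^esub> c) = 0))"
    by (simp only: dot_mult mod_add_left_eq sum.swap[of _ A ?C])
  also have "\<dots> = (\<Sum>a\<in>A. \<Sum>b\<in>A. \<Sum>c\<in>A. 5 ^ n / 5)"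
    using carr free by (intro sum.cong refl, subst sum_dot_eq_0) auto
  also have "\<dots> = 5 ^ n / 5 * ?S ^ 3" by (simp add: power3_eq_cube)
  finally have T: "(\<Sum>u\<in>?C. \<Sum>a\<in>A. \<Sum>b\<in>A. \<Sum>c\<in>A.
      of_bool ((dot n u a + dot n u b + dot n u c) mod 5 = 0) :: real) = 5 ^ n / 5 * ?S ^ 3" .
  have eq_iff: "dot n u a = dot n u b \<longleftrightarrow> dot n u (a \<otimes>\<^bsub>Z5_power n\<^esub> inv\<^bsub>Z5_power n\<^esub> b) = 0"
    if "a \<in> A" "b \<in> A" for u a b
  proof -
    let ?d = "a \<otimes>\<^bsub>Z5_power n\<^esub> inv\<^bsub>Z5_power n\<^esub> b"
    have "a = ?d \<otimes>\<^bsub>Z5_power n\<^esub> b" using that carr by (simp add: m_assoc)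
    then have "dot n u a = (dot n u ?d + dot n u b) mod 5" by (metis dot_mult)
    moreover have "dot n u ?d \<in> {0..<5}" "dot n u b \<in> {0..<5}" by (auto simp: dot_def)
    ultimately show ?thesis by simp presburger
  qed
  have "(\<Sum>u\<in>?C. \<Sum>a\<in>A. \<Sum>b\<in>A. of_bool (dot n u a = dot n u b) :: real) =
      (\<Sum>a\<in>A. \<Sum>b\<in>A. \<Sum>u\<in>?C. of_bool (dot n u a = dot n u b))"
    by (simp only: sum.swap[of _ A ?C])
  also have "\<dots> = (\<Sum>a\<in>A. \<Sum>b\<in>A. 5 ^ n / 5 + 4 * 5 ^ n / 5 * of_bool (a = b))"
  proof (intro sum.cong refl)
    fix a b assume ab: "a \<in> A" "b \<in> A"
    have "a \<otimes>\<^bsub>Z5_power n\<^esub> inv\<^bsub>Z5_power n\<^esub> b = \<one>\<^bsub>Z5_power n\<^esub> \<longleftrightarrow> a = b"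
      using ab carr by (metis inv_equality inv_inv inv_closed r_inv)
    then show "(\<Sum>u\<in>?C. of_bool (dot n u a = dot n u b) :: real) = 5 ^ n / 5 + 4 * 5 ^ n / 5 * of_bool (a = b)"
      using ab carr by (simp only: eq_iff sum_dot_eq_0 m_closed inv_closed)
  qed
  also have "\<dots> = 5 ^ n / 5 * ?S ^ 2 + 4 * 5 ^ n / 5 * ?S"
  proof -
    have "(\<Sum>b\<in>A. of_bool (a = b) :: real) = 1" if "a \<in> A" for a
      using fin that by (simp add: of_bool_def)
    then have "(\<Sum>a\<in>A. \<Sum>b\<in>A. 5 ^ n / 5 + 4 * 5 ^ n / 5 * of_bool (a = b)) =
        (\<Sum>a\<in>A. ?S * (5 ^ n / 5) + 4 * 5 ^ n / 5)"
      by (intro sum.cong refl) (simp only: sum.distrib sum_distrib_left[symmetric], simp)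
    then show ?thesis by (simp add: power2_eq_square field_simps)
  qed
  finally have Q: "(\<Sum>u\<in>?C. \<Sum>a\<in>A. \<Sum>b\<in>A. of_bool (dot n u a = dot n u b) :: real) =
      5 ^ n / 5 * ?S ^ 2 + 4 * 5 ^ n / 5 * ?S" .
  have "dot n u ` A \<subseteq> {0..<5}" for u by (auto simp: dot_def)
  note cubic_form_slices[OF fin this]
  then have "(\<Sum>u\<in>?C. cubic_form (card (slice (dot n u) A 0))
      (card (slice (dot n u) A 1)) (card (slice (dot n u) A 2))
      (card (slice (dot n u) A 3)) (card (slice (dot n u) A 4))) =
    7 * (5 ^ n / 5 * ?S ^ 3) + 3 * ?S * (5 ^ n / 5 * ?S ^ 2 + 4 * 5 ^ n / 5 * ?S) - 5 ^ n * (2 * ?S ^ 3)"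
    using card_carrier_Z5_power[of n]
    by (simp only: sum_subtractf sum.distrib T Q flip: sum_distrib_left) simp
  also have "\<dots> = 12 * 5 ^ n / 5 * ?S ^ 2" by (simp add: field_simps power2_eq_square power3_eq_cube)
  finally show ?thesis .
qed

section \<open>Large sets whose threefold sumset is not the whole group\<close>

lemma product_free_in_two_fibers:
  assumes n: "n \<ge> 1" and A: "A \<subseteq> carrier (Z5_power n)"
    and free: "\<And>x y z. x \<in> A \<Longrightarrow> y \<in> A \<Longrightarrow> z \<in> A \<Longrightarrow>
      x \<otimes>\<^bsub>Z5_power n\<^esub> y \<otimes>\<^bsub>Z5_power n\<^esub> z \<noteq> \<one>\<^bsub>Z5_power n\<^esub>"
    and large: "3 * 5 ^ (n - 1) < 2 * card A"
  obtains \<phi> p q where "Z5_epi (Z5_power n) \<phi>" "p \<in> {0..<5}" "q \<in> {0..<5}" "p \<noteq> q"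
    "A \<subseteq> Z5_epi.fiber (Z5_power n) \<phi> p \<union> Z5_epi.fiber (Z5_power n) \<phi> q"
proof -
  let ?C = "carrier (Z5_power n)" and ?one = "\<one>\<^bsub>Z5_power n\<^esub>" and ?S = "real (card A)"
  interpret comm_group "Z5_power n" by (rule comm_group_Z5_power)
  let ?F = "\<lambda>u. cubic_form (card (slice (dot n u) A 0))
      (card (slice (dot n u) A 1)) (card (slice (dot n u) A 2))
      (card (slice (dot n u) A 3)) (card (slice (dot n u) A 4))"
  have pw: "(5::nat) ^ n = 5 * 5 ^ (n - 1)" using n by (cases n) auto
  have "\<exists>u\<in>?C - {?one}. ?F u < 0"
  proof (rule ccontr)
    assume "\<not> ?thesis"
    then have "0 \<le> (\<Sum>u\<in>?C - {?one}. ?F u)" by (intro sum_nonneg) force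
    also have "\<dots> = (\<Sum>u\<in>?C. ?F u) - ?F ?one"
      by (simp add: sum_diff1 finite_carrier_Z5_power)
    \<comment> \<open>All of \<open>A\<close> lies in slice 0 of the trivial character, so
      \<open>T = S^3\<close> and \<open>Q = S^2\<close>, and \<open>7 + 3 - 2 = 8\<close>.\<close>
    also have "?F ?one = 8 * ?S ^ 3"
      by (simp add: dot_one cubic_form_def power2_eq_square power3_eq_cube)
    finally have "8 * ?S ^ 3 \<le> 12 * 5 ^ n / 5 * ?S ^ 2"
      using sum_cubic_form[OF A free] by simp
    moreover have "real (5 ^ n) = 5 * 5 ^ (n - 1)" by (simp only: pw) simp
    ultimately have "4 * ?S ^ 2 * (2 * ?S) \<le> 4 * ?S ^ 2 * (3 * 5 ^ (n - 1))"
      by (simp add: power2_eq_square power3_eq_cube)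
    moreover have "real (3 * 5 ^ (n - 1)) < real (2 * card A)" using large by (simp only: of_nat_less_iff)
    moreover have "0 < ?S" using large by auto
    ultimately show False by simp
  qed
  then obtain u where u: "u \<in> ?C" "u \<noteq> ?one" "?F u < 0" by blast
  interpret Z5_epi "Z5_power n" "dot n u" using Z5_epi_dot u by blast
  have "3 * card (fiber 0) < 2 * card A"
    using large card_fiber[of 0] order_Z5_power[of n] pw by simp
  from cubic_form_nonneg_or_two_fibers[OF order_Z5_power A free this]
  obtain p q where "p \<in> {0..<5}" "q \<in> {0..<5}" "p \<noteq> q" "A \<subseteq> fiber p \<union> fiber q"
    using u(3) by (auto simp only: not_le[symmetric])
  then show ?thesis by (rule that[OF Z5_epi_axioms])
qed

lemma noncovering_in_two_fibers:
  assumes n: "n \<ge> 1" and A: "A \<subseteq> carrier (Z5_power n)"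
    and nc: "fold_sumset (Z5_power n) 3 A \<noteq> carrier (Z5_power n)"
    and large: "3 * 5 ^ (n - 1) < 2 * card A"
  obtains \<phi> p q where "Z5_epi (Z5_power n) \<phi>" "p \<in> {0..<5}" "q \<in> {0..<5}" "p \<noteq> q"
    "A \<subseteq> Z5_epi.fiber (Z5_power n) \<phi> p \<union> Z5_epi.fiber (Z5_power n) \<phi> q"
proof -
  interpret comm_group "Z5_power n" by (rule comm_group_Z5_power)
  let ?C = "carrier (Z5_power n)"
  have carr: "x \<in> ?C" if "x \<in> A" for x using A that by auto
  obtain g where g: "g \<in> ?C"
    and g_not: "\<And>x y z. x \<in> A \<Longrightarrow> y \<in> A \<Longrightarrow> z \<in> A \<Longrightarrow> x \<otimes>\<^bsub>Z5_power n\<^esub> y \<otimes>\<^bsub>Z5_power n\<^esub> z \<noteq> g"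
  proof -
    have "fold_sumset (Z5_power n) 3 A \<subseteq> ?C" using carr by (auto simp: fold_sumset_3[OF A])
    then obtain g where "g \<in> ?C" "g \<notin> fold_sumset (Z5_power n) 3 A" using nc by blast
    then show ?thesis using that[of g] unfolding fold_sumset_3[OF A] by blast
  qed
  \<comment> \<open>Additively \<open>t = 3g\<close>, so \<open>g + 3t = 10g = 0\<close>:
    translating \<open>A\<close> by \<open>t\<close> moves the missed element \<open>g\<close> to
    the identity.\<close>
  define t where "t = (\<lambda>i\<in>{..<n}. (3 * g i) mod 5)"
  have t: "t \<in> ?C" by (auto simp: t_def carrier_Z5_power)
  have ttt: "g \<otimes>\<^bsub>Z5_power n\<^esub> (t \<otimes>\<^bsub>Z5_power n\<^esub> t \<otimes>\<^bsub>Z5_power n\<^esub> t) = \<one>\<^bsub>Z5_power n\<^esub>"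
  proof -
    have three: "((k mod 5 + k mod 5) mod 5 + k mod 5) mod 5 = (k + k + k) mod 5" for k :: int
      by (simp only: mod_add_eq)
    have "(k + (((3 * k) mod 5 + (3 * k) mod 5) mod 5 + (3 * k) mod 5) mod 5) mod 5 =
        (k + (3 * k + 3 * k + 3 * k)) mod 5" for k :: int
      unfolding three by (rule mod_add_right_eq)
    then have "(k + (((3 * k) mod 5 + (3 * k) mod 5) mod 5 + (3 * k) mod 5) mod 5) mod 5 = 0" for k :: int
      by simp
    then show ?thesis by (auto simp: mult_Z5_power one_Z5_power t_def fun_eq_iff restrict_def)
  qed
  let ?A = "(\<lambda>x. x \<otimes>\<^bsub>Z5_power n\<^esub> t) ` A"
  have "card ?A = card A"
    using carr t by (intro card_image) (auto simp: inj_on_def)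
  moreover have "?A \<subseteq> ?C" using carr t by auto
  moreover have "x \<otimes>\<^bsub>Z5_power n\<^esub> y \<otimes>\<^bsub>Z5_power n\<^esub> z \<noteq> \<one>\<^bsub>Z5_power n\<^esub>"
    if xyz: "x \<in> ?A" "y \<in> ?A" "z \<in> ?A" for x y z
  proof
    assume eq: "x \<otimes>\<^bsub>Z5_power n\<^esub> y \<otimes>\<^bsub>Z5_power n\<^esub> z = \<one>\<^bsub>Z5_power n\<^esub>"
    obtain a b c where abc: "a \<in> A" "b \<in> A" "c \<in> A" "x = a \<otimes>\<^bsub>Z5_power n\<^esub> t"
      "y = b \<otimes>\<^bsub>Z5_power n\<^esub> t" "z = c \<otimes>\<^bsub>Z5_power n\<^esub> t" using xyz by blast
    have "x \<otimes>\<^bsub>Z5_power n\<^esub> y \<otimes>\<^bsub>Z5_power n\<^esub> z = (a \<otimes>\<^bsub>Z5_power n\<^esub> b \<otimes>\<^bsub>Z5_power n\<^esub> c) \<otimes>\<^bsub>Z5_power n\<^esub>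
        (t \<otimes>\<^bsub>Z5_power n\<^esub> t \<otimes>\<^bsub>Z5_power n\<^esub> t)"
      using abc carr t by (simp add: m_ac)
    then have "(a \<otimes>\<^bsub>Z5_power n\<^esub> b \<otimes>\<^bsub>Z5_power n\<^esub> c) \<otimes>\<^bsub>Z5_power n\<^esub>
        (t \<otimes>\<^bsub>Z5_power n\<^esub> t \<otimes>\<^bsub>Z5_power n\<^esub> t) = g \<otimes>\<^bsub>Z5_power n\<^esub> (t \<otimes>\<^bsub>Z5_power n\<^esub> t \<otimes>\<^bsub>Z5_power n\<^esub> t)"
      using eq ttt by simp
    then have "a \<otimes>\<^bsub>Z5_power n\<^esub> b \<otimes>\<^bsub>Z5_power n\<^esub> c = g" using abc carr t g by simp
    then show False using g_not abc by blast
  qed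
  ultimately obtain \<phi> p q where \<phi>: "Z5_epi (Z5_power n) \<phi>" and pq: "p \<in> {0..<5}" "q \<in> {0..<5}" "p \<noteq> q"
    and sub: "?A \<subseteq> Z5_epi.fiber (Z5_power n) \<phi> p \<union> Z5_epi.fiber (Z5_power n) \<phi> q"
    using product_free_in_two_fibers[of n ?A] n large by metis
  interpret Z5_epi "Z5_power n" \<phi> by (rule \<phi>)
  have "A \<subseteq> fiber ((p - \<phi> t) mod 5) \<union> fiber ((q - \<phi> t) mod 5)"
  proof
    fix x assume x: "x \<in> A"
    then have "(\<phi> x + \<phi> t) mod 5 \<in> {p, q}" using sub carr t by (auto simp: fiber_def)
    moreover have "\<phi> x \<in> {0..<5}" using phi_range carr x by blast
    ultimately have "\<phi> x \<in> {(p - \<phi> t) mod 5, (q - \<phi> t) mod 5}" by (auto simp: mod_simps)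
    then show "x \<in> fiber ((p - \<phi> t) mod 5) \<union> fiber ((q - \<phi> t) mod 5)"
      using x carr by (auto simp: fiber_def)
  qed
  moreover have "(p - \<phi> t) mod 5 \<noteq> (q - \<phi> t) mod 5"
  proof
    assume "(p - \<phi> t) mod 5 = (q - \<phi> t) mod 5"
    then have "((p - \<phi> t) mod 5 + \<phi> t) mod 5 = ((q - \<phi> t) mod 5 + \<phi> t) mod 5" by simp
    then show False using pq by (simp add: mod_simps)
  qed
  ultimately show ?thesis by (intro that[OF \<phi>]) auto
qed


section \<open>Extremal sets\<close>

lemma fixpoint_free_involution_transversal:
  assumes "finite X" and inv: "\<And>x. x \<in> X \<Longrightarrow> h x \<in> X \<and> h (h x) = x \<and> h x \<noteq> x"
  obtains B where "B \<union> h ` B = X" "B \<inter> h ` B = {}" "inj_on h B"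
proof -
  obtain r :: "'a \<Rightarrow> nat" where r: "inj_on r X"
    using finite_imp_inj_to_nat_seg[OF assms(1)] by blast
  \<comment> \<open>From each orbit \<open>x\<close>, \<open>h x\<close> the element with the
    smaller label is taken; the labels differ because \<open>h\<close> has no fixed point.\<close>
  define B where "B = {x \<in> X. r x < r (h x)}"
  have "x \<in> B \<or> h x \<in> B" if "x \<in> X" for x
  proof -
    have "r (h x) \<noteq> r x" using r inv[OF that] that by (auto dest: inj_onD)
    then have "r x < r (h x) \<or> r (h x) < r x" by linarith
    then show ?thesis using inv[OF that] that by (auto simp: B_def)
  qed
  then have "B \<union> h ` B = X" using inv by (force simp: B_def)
  moreover have "B \<inter> h ` B = {}" using inv by (force simp: B_def)
  moreover have "inj_on h B" by (rule inj_on_inverseI[of _ h]) (use inv in \<open>auto simp: B_def\<close>)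
  ultimately show ?thesis by (rule that)
qed

section \<open>Unions of two fibers, and an aperiodic extremal set\<close>

context Z5_epi
begin

lemma two_fibers_noncovering:
  assumes "p \<in> {0..<5}" "q \<in> {0..<5}" "p \<noteq> q"
  shows "fold_sumset G 3 (fiber p \<union> fiber q) \<noteq> carrier G"
proof -
  \<comment> \<open>The values \<open>3p\<close>, \<open>2p + q\<close>, \<open>p + 2q\<close>,
    \<open>3q\<close> form a progression with nonzero difference \<open>q - p\<close>; its fifth
    term \<open>4q - p\<close> is the residue left out.\<close>
  obtain x where x: "x \<in> carrier G" "\<phi> x = (4 * q - p) mod 5" using phi_surj by (metis atLeastLessThan_iff
        pos_mod_bound pos_mod_sign zero_less_numeral)
  have pq: "p \<in> {0,1,2,3,4}" "q \<in> {0,1,2,3,4}" using assms by auto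
  have "a \<otimes> b \<otimes> c \<noteq> x" if abc: "a \<in> fiber p \<union> fiber q" "b \<in> fiber p \<union> fiber q" "c \<in> fiber p \<union> fiber q" for a b c
  proof
    assume "a \<otimes> b \<otimes> c = x"
    moreover have carr: "a \<in> carrier G" "b \<in> carrier G" "c \<in> carrier G" using abc by (auto simp: fiber_def)
    ultimately have "(\<phi> a + \<phi> b + \<phi> c) mod 5 = (4 * q - p) mod 5"
      using x phi_mult[of "a \<otimes> b" c] phi_mult[of a b] by (simp add: mod_add_left_eq)
    moreover have "\<phi> a \<in> {p, q}" "\<phi> b \<in> {p, q}" "\<phi> c \<in> {p, q}" using abc by (auto simp: fiber_def)
    ultimately show False using pq \<open>p \<noteq> q\<close> by auto
  qed
  moreover have "fiber p \<union> fiber q \<subseteq> carrier G" by (auto simp: fiber_def)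
  ultimately have "x \<notin> fold_sumset G 3 (fiber p \<union> fiber q)" by (auto simp: fold_sumset_3)
  then show ?thesis using x by blast
qed

text \<open>The union of two fibers does not cover, so a maximal set inside it must fill it. It is
  then invariant under the kernel, which aperiodicity makes trivial.\<close>

lemma max_noncovering_in_two_fibers:
  assumes pq: "p \<in> {0..<5}" "q \<in> {0..<5}" "p \<noteq> q" and A: "A \<subseteq> fiber p \<union> fiber q"
    and max: "max_noncovering G 3 A" and ap: "aperiodic G A"
  shows "A = fiber p \<union> fiber q" and "fiber 0 = {\<one>}"
proof -
  have sub: "fiber p \<union> fiber q \<subseteq> carrier G" by (auto simp: fiber_def)
  show A_eq: "A = fiber p \<union> fiber q"
  proof (rule ccontr)
    assume "A \<noteq> fiber p \<union> fiber q"
    then obtain g where g: "g \<in> fiber p \<union> fiber q" "g \<notin> A" using A by blast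
    then have "fold_sumset G 3 (insert g A) = carrier G"
      using max sub unfolding max_noncovering_def by blast
    moreover have "insert g A \<subseteq> fiber p \<union> fiber q" using g A by blast
    then have "fold_sumset G 3 (insert g A) \<subseteq> fold_sumset G 3 (fiber p \<union> fiber q)"
      unfolding fold_sumset_def by blast
    moreover have "fold_sumset G 3 (fiber p \<union> fiber q) \<subseteq> carrier G"
      using sub by (auto simp: fold_sumset_3)
    ultimately show False using two_fibers_noncovering[OF pq] by blast
  qed
  have shift: "fiber i #> h = fiber i" if h: "h \<in> fiber 0" for i h
  proof (intro equalityI subsetI)
    fix x assume "x \<in> fiber i"
    then have "x \<otimes> inv h \<in> fiber i" "x = (x \<otimes> inv h) \<otimes> h"
      using h by (auto simp: fiber_def m_assoc)
    then show "x \<in> fiber i #> h" by (auto simp: r_coset_def)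
  qed (use h in \<open>auto simp: fiber_def r_coset_def\<close>)
  have "fiber 0 \<subseteq> period G A"
  proof
    fix h assume h: "h \<in> fiber 0"
    have "A #> h = (fiber p #> h) \<union> (fiber q #> h)" unfolding A_eq r_coset_def by blast
    then show "h \<in> period G A" using shift[OF h] h A_eq by (auto simp: period_def fiber_def)
  qed
  then show "fiber 0 = {\<one>}" using ap by (auto simp: aperiodic_def fiber_def)
qed

text \<open>A trivial kernel makes \<open>\<phi>\<close> an isomorphism onto Z_5, and the set
  becomes \<open>{0, 1}\<close>: the extremal example for \<open>n = 1\<close>.\<close>

lemma two_fibers_max_noncovering:
  assumes triv: "fiber 0 = {\<one>}"
  shows "aperiodic G (fiber 0 \<union> fiber 1)" "max_noncovering G 3 (fiber 0 \<union> fiber 1)"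
    "card (fiber 0 \<union> fiber 1) = 2"
proof -
  let ?A = "fiber 0 \<union> fiber 1"
  have sub: "?A \<subseteq> carrier G" by (auto simp: fiber_def)
  have inj: "x = y" if "x \<in> carrier G" "y \<in> carrier G" "\<phi> x = \<phi> y" for x y
  proof -
    have "x \<otimes> inv y \<in> fiber 0" using that by (auto simp: fiber_def mod_simps)
    then have "x \<otimes> inv y = \<one>" using triv by blast
    then show ?thesis using that by (metis inv_closed inv_equality inv_inv)
  qed
  obtain e where e: "e \<in> carrier G" "\<phi> e = 1" using phi_surj[of 1] by auto
  show "card ?A = 2"
  proof -
    have "fiber 0 \<inter> fiber 1 = {}" by (auto simp: fiber_def)
    then show ?thesis using triv card_fiber_eq[of 1] finite_fiber by (simp add: card_Un_disjoint)
  qed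
  have "g = \<one>" if g: "g \<in> carrier G" "?A #> g = ?A" for g
  proof -
    have "x \<otimes> g \<in> ?A" if "x \<in> ?A" for x using that g(2) unfolding r_coset_def by blast
    then have "\<one> \<otimes> g \<in> ?A" "e \<otimes> g \<in> ?A" using e by (simp_all add: fiber_def)
    then have "\<phi> g = 0" using g(1) e by (auto simp: fiber_def)
    then show ?thesis using inj[of g \<one>] g by simp
  qed
  moreover have "?A #> \<one> = ?A" using sub by (simp add: coset_mult_one)
  ultimately show "aperiodic G ?A" by (auto simp: aperiodic_def period_def)
  have "fold_sumset G 3 (insert g ?A) = carrier G" if g: "g \<in> carrier G - ?A" for g
  proof -
    have "\<phi> g \<in> {0..<5}" using g phi_range by blast
    then have gj: "\<phi> g = 2 \<or> \<phi> g = 3 \<or> \<phi> g = 4" using g by (auto simp: fiber_def)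
    have "x \<in> fold_sumset G 3 (insert g ?A)" if x: "x \<in> carrier G" for x
    proof -
      have "\<phi> x \<in> {0..<5}" using x phi_range by blast
      then have "\<phi> x = 0 \<or> \<phi> x = 1 \<or> \<phi> x = 2 \<or> \<phi> x = 3 \<or> \<phi> x = 4" by auto
      \<comment> \<open>For each of the residues 2, 3, 4 of \<open>g\<close>, the threefold sums of
        0, 1 and that residue give all of Z_5.\<close>
      then have "\<exists>a\<in>{\<one>, e, g}. \<exists>b\<in>{\<one>, e, g}. \<exists>c\<in>{\<one>, e, g}. (\<phi> a + \<phi> b + \<phi> c) mod 5 = \<phi> x"
        using gj e by auto
      then obtain a b c where abc: "a \<in> {\<one>, e, g}" "b \<in> {\<one>, e, g}" "c \<in> {\<one>, e, g}"
        "(\<phi> a + \<phi> b + \<phi> c) mod 5 = \<phi> x" by blast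
      have "{\<one>, e, g} \<subseteq> carrier G" using e g by auto
      with abc have carr: "a \<in> carrier G" "b \<in> carrier G" "c \<in> carrier G" by auto
      then have "\<phi> (a \<otimes> b \<otimes> c) = \<phi> x" using abc by (simp add: mod_add_left_eq)
      then have "x = a \<otimes> b \<otimes> c" using inj carr x by (metis m_closed)
      moreover have "{\<one>, e, g} \<subseteq> insert g ?A" using e by (auto simp: fiber_def)
      ultimately show ?thesis using abc sub g by (subst fold_sumset_3) blast+
    qed
    moreover have "fold_sumset G 3 (insert g ?A) \<subseteq> carrier G"
      using sub g by (subst fold_sumset_3) auto
    ultimately show ?thesis by blast
  qed
  then show "max_noncovering G 3 ?A"
    using two_fibers_noncovering[of 0 1] by (auto simp: max_noncovering_def)
qed

text \<open>Exponent five serves twice: powers of \<open>e\<close> reduce modulo 5, and inversion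
  has no fixed point on the nontrivial part of the kernel, which therefore splits as
  \<open>B\<close> and its inverses. Five kernel elements ensure that \<open>B\<close> has at least
  two.\<close>

lemma aperiodic_max_noncovering_exists:
  assumes exp5: "\<And>x. x \<in> carrier G \<Longrightarrow> x [^] (5::nat) = \<one>" and big: "5 \<le> card (fiber 0)"
  obtains A where "A \<subseteq> carrier G" "aperiodic G A" "max_noncovering G 3 A"
    "2 * card A + 1 = 3 * card (fiber 0)"
proof -
  let ?F = "fiber 0"
  have F: "subgroup ?F G" by (rule subgroup_fiber_0)
  have Fc: "x \<in> carrier G" if "x \<in> ?F" for x using that by (simp add: fiber_def)
  have Fm: "x \<otimes> y \<in> ?F" if "x \<in> ?F" "y \<in> ?F" for x y using that F by (rule subgroup.m_closed[rotated])
  have Fi: "inv x \<in> ?F" if "x \<in> ?F" for x using that F by (rule subgroup.m_inv_closed[rotated])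
  have F1: "\<one> \<in> ?F" using F by (rule subgroup.one_closed)
  have invol: "inv x \<noteq> x" if "x \<in> ?F - {\<one>}" for x
  proof
    assume "inv x = x"
    have x: "x \<in> carrier G" using that Fc by blast
    then have "x \<otimes> x = \<one>" using \<open>inv x = x\<close> r_inv[of x] by simp
    moreover have "x [^] (5::nat) = (x \<otimes> x) \<otimes> (x \<otimes> x) \<otimes> x"
      using x by (simp add: numeral_eq_Suc m_assoc)
    ultimately have "x = \<one>" using exp5[OF x] x by simp
    then show False using that by simp
  qed
  have hinv: "inv x \<in> ?F - {\<one>} \<and> inv (inv x) = x \<and> inv x \<noteq> x" if "x \<in> ?F - {\<one>}" for x
    using that invol[OF that] Fc Fi by (auto simp: inv_eq_1_iff)
  obtain B where B: "B \<union> m_inv G ` B = ?F - {\<one>}" "B \<inter> m_inv G ` B = {}" "inj_on (m_inv G) B"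
    by (rule fixpoint_free_involution_transversal[OF _ hinv]) (use finite_fiber in auto)
  have BF: "b \<in> ?F" "b \<noteq> \<one>" if "b \<in> B" for b using that B by auto
  have finB: "finite B" using BF finite_fiber by (meson finite_subset subsetI)
  have "card ?F - 1 = card (B \<union> m_inv G ` B)" using F1 finite_fiber B(1) by simp
  also have "\<dots> = 2 * card B" using B(2,3) finB by (simp add: card_Un_disjoint card_image)
  finally have cardB: "card ?F = 2 * card B + 1" using big by linarith
  \<comment> \<open>Having two elements in \<open>B\<close> permits choosing one different from a
    prescribed \<open>x\<close>, which keeps complementary factors away from the identity.\<close>
  have avoid: "\<exists>b\<in>B. b \<noteq> x" for x
  proof (rule ccontr)
    assume "\<not> ?thesis"
    then have "card B \<le> card {x}" by (intro card_mono) auto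
    then show False using cardB big by simp
  qed
  have split: "\<exists>f h. f \<in> ?F - {\<one>} \<and> h \<in> ?F - {\<one>} \<and> f \<otimes> h = x" if x: "x \<in> ?F" for x
  proof -
    obtain b where b: "b \<in> B" "b \<noteq> x" using avoid by blast
    then have bF: "b \<in> ?F" "b \<noteq> \<one>" "b \<in> carrier G" using BF Fc by auto
    have "inv b \<otimes> x \<in> ?F" using bF x Fm Fi by blast
    moreover have "b \<otimes> (inv b \<otimes> x) = x" using bF x Fc by (simp flip: m_assoc)
    moreover then have "inv b \<otimes> x \<noteq> \<one>" using b bF by auto
    ultimately show ?thesis using bF by blast
  qed
  obtain e where e: "e \<in> carrier G" "\<phi> e = 1" using phi_surj[of 1] by auto
  have phie: "\<phi> (e [^] k) = int k mod 5" for k :: nat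
    using e by (induction k) (simp_all add: mod_simps algebra_simps)
  \<comment> \<open>Coordinates of the set: the pair \<open>(i, f)\<close> stands for
    \<open>e [^] i \<otimes> f\<close>.\<close>
  define S where "S = insert (1::nat, \<one>) ({2} \<times> B \<union> {3} \<times> (?F - {\<one>}))"
  define A where "A = (\<lambda>(i, f). e [^] i \<otimes> f) ` S"
  have S_F: "i < 5" "f \<in> ?F" if "(i, f) \<in> S" for i f using that BF F1 by (auto simp: S_def)
  have phi_eF: "\<phi> (e [^] k \<otimes> f) = int k mod 5" if "f \<in> ?F" for k :: nat and f
    using that e phie by (simp add: fiber_def)
  have phi_S: "\<phi> (e [^] i \<otimes> f) = int i" if "i < 5" "f \<in> ?F" for i :: nat and f
    using that phi_eF by simp
  have inj: "i = j \<and> f = h" if "i < 5" "j < 5" "f \<in> ?F" "h \<in> ?F" "e [^] i \<otimes> f = e [^] j \<otimes> h" for i j :: nat and f h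
  proof -
    have "i = j" using phi_S[of i f] phi_S[of j h] that by simp
    then show ?thesis using that e Fc by simp
  qed
  have A_iff: "e [^] i \<otimes> f \<in> A \<longleftrightarrow> (i, f) \<in> S" if "i < 5" "f \<in> ?F" for i :: nat and f
  proof
    assume "e [^] i \<otimes> f \<in> A"
    then obtain j h where jh: "(j, h) \<in> S" "e [^] i \<otimes> f = e [^] j \<otimes> h" unfolding A_def by auto
    then have "i = j \<and> f = h" using inj[of i j f h] that S_F[OF jh(1)] by blast
    then show "(i, f) \<in> S" using jh by simp
  next
    assume "(i, f) \<in> S"
    then show "e [^] i \<otimes> f \<in> A" unfolding A_def by (rule rev_image_eqI) simp
  qed
  have AC: "A \<subseteq> carrier G" using S_F Fc e by (auto simp: A_def)
  have rep: "\<exists>(i::nat) f. i < 5 \<and> f \<in> ?F \<and> x = e [^] i \<otimes> f" if x: "x \<in> carrier G" for x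
  proof -
    define i where "i = nat (\<phi> x)"
    have i: "i < 5" "int i = \<phi> x" using phi_range[OF x] by (auto simp: i_def)
    have "inv (e [^] i) \<otimes> x \<in> ?F" using x e phie[of i] i by (simp add: fiber_def mod_simps)
    moreover have "x = e [^] i \<otimes> (inv (e [^] i) \<otimes> x)" using x e by (simp flip: m_assoc)
    ultimately show ?thesis using i by blast
  qed
  have prod3: "(e [^] i \<otimes> f) \<otimes> (e [^] j \<otimes> h) \<otimes> (e [^] k \<otimes> l) = e [^] (i + j + k) \<otimes> (f \<otimes> h \<otimes> l)"
    if "f \<in> ?F" "h \<in> ?F" "l \<in> ?F" for i j k :: nat and f h l
    using that e Fc by (simp add: m_ac flip: nat_pow_mult)
  have in_sumset: "e [^] r \<otimes> x \<in> fold_sumset G 3 X"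
    if "X \<subseteq> carrier G" "f \<in> ?F" "h \<in> ?F" "l \<in> ?F"
      "e [^] i \<otimes> f \<in> X" "e [^] j \<otimes> h \<in> X" "e [^] k \<otimes> l \<in> X"
      "f \<otimes> h \<otimes> l = x" "i + j + k = r + 5 * t" for X x and i j k r t :: nat and f h l
  proof -
    have "e [^] (r + 5 * t) = e [^] r"
      using e exp5[of e] by (simp add: nat_pow_pow[symmetric] flip: nat_pow_mult)
    then have "e [^] r \<otimes> x = (e [^] i \<otimes> f) \<otimes> (e [^] j \<otimes> h) \<otimes> (e [^] k \<otimes> l)"
      using prod3[of f h l i j k] that by simp
    then show ?thesis using that unfolding fold_sumset_3[OF that(1)] by blast
  qed
  have S1: "(1, \<one>) \<in> S" and S2: "\<And>b. b \<in> B \<Longrightarrow> (2, b) \<in> S" and S3: "\<And>f. f \<in> ?F - {\<one>} \<Longrightarrow> (3, f) \<in> S"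
    by (auto simp: S_def)
  have in_A: "e [^] i \<otimes> f \<in> A" if "(i, f) \<in> S" for i f
    using that A_iff[OF S_F[OF that]] by simp
  obtain b0 where b0: "b0 \<in> B" using avoid by blast
  have one_notin: "\<one> \<notin> fold_sumset G 3 A"
  proof
    assume "\<one> \<in> fold_sumset G 3 A"
    then obtain x y z where "x \<in> A" "y \<in> A" "z \<in> A" and one: "\<one> = x \<otimes> y \<otimes> z"
      unfolding fold_sumset_3[OF AC] by blast
    then obtain i j k f h l where S: "(i, f) \<in> S" "(j, h) \<in> S" "(k, l) \<in> S"
      and xyz: "x = e [^] i \<otimes> f" "y = e [^] j \<otimes> h" "z = e [^] k \<otimes> l"
      unfolding A_def by auto
    have fhl: "f \<in> ?F" "h \<in> ?F" "l \<in> ?F" using S S_F by blast+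
    have eq: "e [^] (i + j + k) \<otimes> (f \<otimes> h \<otimes> l) = \<one>"
      using one prod3[OF fhl] xyz by simp
    have "int (i + j + k) mod 5 = \<phi> \<one>"
      using phi_eF[OF Fm[OF Fm[OF fhl(1,2)] fhl(3)], of "i + j + k"] unfolding eq by (rule sym)
    then have "int (i + j + k) mod 5 = 0" by (simp only: phi_one)
    then have "(i + j + k) mod 5 = 0" by presburger
    moreover have ijk: "i \<in> {1,2,3}" "j \<in> {1,2,3}" "k \<in> {1,2,3}" using S by (auto simp: S_def)
    \<comment> \<open>The exponent sum lies between 3 and 9, so 5 is the only multiple of 5. Only 1,
      1, 3 and 1, 2, 2 remain; they fail because the identity is absent from class 3 and no two
      elements of \<open>B\<close> are mutually inverse.\<close>
    ultimately have five: "i + j + k = 5" by auto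
    then have prod: "f \<otimes> h \<otimes> l = \<one>" using eq exp5[of e] e fhl Fc by simp
    have BB: "b \<otimes> c \<noteq> \<one>" if "b \<in> B" "c \<in> B" for b c
    proof
      assume "b \<otimes> c = \<one>"
      then have "b = inv c" using that BF Fc by (metis inv_equality)
      then show False using B(2) that by blast
    qed
    have D1: "f = \<one>" if "(1, f) \<in> S" for f using that by (simp add: S_def)
    have D2: "f \<in> B" if "(2, f) \<in> S" for f using that by (simp add: S_def)
    have D3: "f \<noteq> \<one>" if "(3, f) \<in> S" for f using that by (simp add: S_def)
    have fhl': "f \<in> carrier G" "h \<in> carrier G" "l \<in> carrier G" using fhl Fc by auto
    consider "i = 1" "j = 1" "k = 3" | "i = 1" "j = 3" "k = 1" | "i = 3" "j = 1" "k = 1"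
      | "i = 1" "j = 2" "k = 2" | "i = 2" "j = 1" "k = 2" | "i = 2" "j = 2" "k = 1"
      using ijk five by auto
    then show False
    proof cases
      case 1
      then show False using S D1[of f] D1[of h] D3[of l] prod fhl' by simp
    next
      case 2
      then show False using S D1[of f] D3[of h] D1[of l] prod fhl' by simp
    next
      case 3
      then show False using S D3[of f] D1[of h] D1[of l] prod fhl' by simp
    next
      case 4
      then show False using S D1[of f] BB[OF D2[of h] D2[of l]] prod fhl' by simp
    next
      case 5
      then show False using S D1[of h] BB[OF D2[of f] D2[of l]] prod fhl' by simp
    next
      case 6
      then show False using S D1[of l] BB[OF D2[of f] D2[of h]] prod fhl' by simp
    qed
  qed
  have covers: "x \<in> fold_sumset G 3 A" if x: "x \<in> carrier G" "x \<noteq> \<one>" for x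
  proof -
    obtain r :: nat and f where r: "r < 5" and f: "f \<in> ?F" and xrf: "x = e [^] r \<otimes> f" using rep[OF x(1)] by blast
    have fc: "f \<in> carrier G" using Fc f .
    \<comment> \<open>The exponents used are 1+1+3, 1+2+3, 1+3+3, 2+3+3 and 3+3+3, that is
      \<open>r + 5\<close> in each case.\<close>
    consider "r = 0" | "r = 1" | "r = 2" | "r = 3" | "r = 4" using r by linarith
    then show ?thesis
    proof cases
      case 1
      then have "f \<noteq> \<one>" using x xrf by auto
      then show ?thesis
        unfolding xrf 1 using fc f
        by (intro in_sumset[OF AC F1 F1 f in_A[OF S1] in_A[OF S1] in_A[OF S3], where t = 1]) auto
    next
      case 2
      obtain b where b: "b \<in> B" "b \<noteq> f" using avoid by blast
      have bc: "b \<in> ?F" "b \<in> carrier G" using BF Fc b by auto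
      have eq: "\<one> \<otimes> b \<otimes> (inv b \<otimes> f) = f" using bc fc by (simp flip: m_assoc)
      then have "inv b \<otimes> f \<noteq> \<one>" using b bc by auto
      then have g: "inv b \<otimes> f \<in> ?F - {\<one>}" using Fm Fi bc f by blast
      show ?thesis
        unfolding xrf 2 using g eq
        by (intro in_sumset[OF AC F1 bc(1) _ in_A[OF S1] in_A[OF S2[OF b(1)]] in_A[OF S3[OF g]], where t = 1]) auto
    next
      case 3
      obtain g h where gh: "g \<in> ?F - {\<one>}" "h \<in> ?F - {\<one>}" "g \<otimes> h = f" using split f by blast
      show ?thesis
        unfolding xrf 3 using gh Fc
        by (intro in_sumset[OF AC F1 _ _ in_A[OF S1] in_A[OF S3[OF gh(1)]] in_A[OF S3[OF gh(2)]], where t = 1]) auto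
    next
      case 4
      have b: "b0 \<in> ?F" "b0 \<in> carrier G" using BF Fc b0 by auto
      obtain g h where gh: "g \<in> ?F - {\<one>}" "h \<in> ?F - {\<one>}" "g \<otimes> h = inv b0 \<otimes> f"
        using split[OF Fm[OF Fi[OF b(1)] f]] by blast
      have "b0 \<otimes> g \<otimes> h = f" using gh b fc Fc by (simp add: m_assoc) (simp flip: m_assoc)
      then show ?thesis
        unfolding xrf 4 using gh
        by (intro in_sumset[OF AC b(1) _ _ in_A[OF S2[OF b0]] in_A[OF S3[OF gh(1)]] in_A[OF S3[OF gh(2)]], where t = 1]) auto
    next
      case 5
      have b: "b0 \<in> ?F" "b0 \<in> carrier G" "b0 \<in> ?F - {\<one>}" using BF Fc b0 by auto
      obtain g h where gh: "g \<in> ?F - {\<one>}" "h \<in> ?F - {\<one>}" "g \<otimes> h = inv b0 \<otimes> f"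
        using split[OF Fm[OF Fi[OF b(1)] f]] by blast
      have "b0 \<otimes> g \<otimes> h = f" using gh b fc Fc by (simp add: m_assoc) (simp flip: m_assoc)
      then show ?thesis
        unfolding xrf 5 using gh
        by (intro in_sumset[OF AC b(1) _ _ in_A[OF S3[OF b(3)]] in_A[OF S3[OF gh(1)]] in_A[OF S3[OF gh(2)]], where t = 1]) auto
    qed
  qed
  have sub3: "fold_sumset G 3 X \<subseteq> carrier G" if "X \<subseteq> carrier G" for X
    using that by (subst fold_sumset_3) auto
  \<comment> \<open>By \<open>covers\<close> the identity is the only element missed, so maximality
    reduces to reaching it with the help of \<open>x\<close>.\<close>
  have insert_covers: "\<one> \<in> fold_sumset G 3 (insert x A)" if x: "x \<in> carrier G" "x \<notin> A" for x
  proof -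
    obtain r :: nat and f where r: "r < 5" and f: "f \<in> ?F" and xrf: "x = e [^] r \<otimes> f" using rep[OF x(1)] by blast
    have fc: "f \<in> carrier G" "inv f \<in> ?F" using Fc Fi f by auto
    have nS: "(r, f) \<notin> S" using A_iff[OF r f] x xrf by simp
    have X: "insert x A \<subseteq> carrier G" using AC x by auto
    have in_X: "e [^] i \<otimes> h \<in> insert x A" if "(i, h) \<in> S" for i h using in_A[OF that] by simp
    have xX: "e [^] r \<otimes> f \<in> insert x A" using xrf by simp
    have one_in: "\<one> \<in> fold_sumset G 3 (insert x A)"
      if "h \<in> ?F" "l \<in> ?F" "e [^] j \<otimes> h \<in> insert x A" "e [^] k \<otimes> l \<in> insert x A"
        "f \<otimes> h \<otimes> l = \<one>" "r + j + k = 5 * t" for j k t :: nat and h l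
      using in_sumset[OF X f that(1,2) xX that(3,4,5), of 0 t] that(6) by simp
    \<comment> \<open>The exponents, starting with that of \<open>x\<close>, are 0+2+3, 1+1+3,
      2+2+1, 3+1+1 and 4+3+3; only the last sums to 10.\<close>
    consider "r = 0" | "r = 1" | "r = 2" | "r = 3" | "r = 4" using r by linarith
    then show ?thesis
    proof cases
      case 1
      obtain b where b: "b \<in> B" "b \<noteq> inv f" using avoid by blast
      have bc: "b \<in> ?F" "b \<in> carrier G" using BF Fc b by auto
      have "f \<otimes> b \<noteq> \<one>" using b bc fc by (metis inv_equality inv_inv m_comm)
      then have g: "inv (f \<otimes> b) \<in> ?F - {\<one>}" using Fm Fi bc f fc by (auto simp: inv_eq_1_iff)
      have "f \<otimes> b \<otimes> inv (f \<otimes> b) = \<one>" using bc fc by simp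
      then show ?thesis
        using g 1 by (intro one_in[OF bc(1) _ in_X[OF S2[OF b(1)]] in_X[OF S3[OF g]], where t = 1]) auto
    next
      case 2
      then have "f \<noteq> \<one>" using nS S1 by auto
      then have g: "inv f \<in> ?F - {\<one>}" using fc by (auto simp: inv_eq_1_iff)
      have "f \<otimes> \<one> \<otimes> inv f = \<one>" using fc by simp
      then show ?thesis
        using 2 by (intro one_in[OF F1 fc(2) in_X[OF S1] in_X[OF S3[OF g]], where t = 1]) auto
    next
      case 3
      show ?thesis
      \<comment> \<open>For \<open>f = \<one>\<close> the new element is used twice, as
        \<open>x \<otimes> x \<otimes> e\<close> is the fifth power of \<open>e\<close>. Otherwise
        \<open>f\<close> is the inverse of an element of \<open>B\<close>, which completes the
        product.\<close>
      proof (cases "f = \<one>")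
        case True
        then show ?thesis
          using 3 by (intro one_in[OF f F1 xX in_X[OF S1], where t = 1]) auto
      next
        case False
        have "f \<in> B \<union> m_inv G ` B" using B(1) f False by blast
        moreover have "f \<notin> B" using nS S2 3 by auto
        ultimately obtain b where b: "b \<in> B" "f = inv b" by blast
        have bc: "b \<in> ?F" "b \<in> carrier G" using BF Fc b by auto
        have "f \<otimes> b \<otimes> \<one> = \<one>" using b bc by simp
        then show ?thesis
          using 3 by (intro one_in[OF bc(1) F1 in_X[OF S2[OF b(1)]] in_X[OF S1], where t = 1]) auto
      qed
    next
      case 4
      then have "f = \<one>" using nS S3 f by blast
      then show ?thesis
        using 4 by (intro one_in[OF F1 F1 in_X[OF S1] in_X[OF S1], where t = 1]) auto
    next
      case 5
      obtain g h where gh: "g \<in> ?F - {\<one>}" "h \<in> ?F - {\<one>}" "g \<otimes> h = inv f" using split fc by blast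
      have "f \<otimes> g \<otimes> h = \<one>" using gh fc Fc by (simp add: m_assoc)
      then show ?thesis
        using gh 5 by (intro one_in[OF _ _ in_X[OF S3[OF gh(1)]] in_X[OF S3[OF gh(2)]], where t = 2]) auto
    qed
  qed
  have "max_noncovering G 3 A"
    unfolding max_noncovering_def
  proof (intro conjI ballI)
    show "fold_sumset G 3 A \<noteq> carrier G" using one_notin by blast
    fix x assume x: "x \<in> carrier G - A"
    have "fold_sumset G 3 A \<subseteq> fold_sumset G 3 (insert x A)" unfolding fold_sumset_def by blast
    moreover have "fold_sumset G 3 (insert x A) \<subseteq> carrier G" using sub3 AC x by auto
    ultimately show "fold_sumset G 3 (insert x A) = carrier G"
      using covers insert_covers x by blast
  qed
  moreover have "aperiodic G A"
  proof -
    have "g = \<one>" if g: "g \<in> carrier G" "A #> g = A" for g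
    proof (rule ccontr)
      \<comment> \<open>A nontrivial period \<open>g\<close> would have \<open>inv g\<close> in the
        sumset; moving \<open>g\<close> into one factor stays in \<open>A\<close> and would produce
        the missed identity.\<close>
      assume "g \<noteq> \<one>"
      then have "inv g \<in> fold_sumset G 3 A" using covers g by (auto simp: inv_eq_1_iff)
      then obtain x y z where xyz: "x \<in> A" "y \<in> A" "z \<in> A" "inv g = x \<otimes> y \<otimes> z"
        unfolding fold_sumset_3[OF AC] by blast
      have "z \<otimes> g \<in> A" using g xyz(3) by (auto simp: r_coset_def)
      moreover have "x \<otimes> y \<otimes> (z \<otimes> g) = \<one>"
        using xyz AC g by (metis l_inv m_assoc m_closed subsetD)
      ultimately show False using one_notin xyz unfolding fold_sumset_3[OF AC] by (metis (mono_tags, lifting) mem_Collect_eq)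
    qed
    moreover have "A #> \<one> = A" using AC by (simp add: coset_mult_one)
    ultimately show ?thesis by (auto simp: aperiodic_def period_def)
  qed
  moreover have "2 * card A + 1 = 3 * card ?F"
  proof -
    have "inj_on (\<lambda>(i, f). e [^] i \<otimes> f) S"
    proof (rule inj_onI)
      fix s t assume st: "s \<in> S" "t \<in> S" "(\<lambda>(i, f). e [^] i \<otimes> f) s = (\<lambda>(i, f). e [^] i \<otimes> f) t"
      obtain i f j h where s: "s = (i, f)" and t: "t = (j, h)" by (metis surj_pair)
      show "s = t"
        using inj[of i j f h] S_F[of i f] S_F[of j h] st unfolding s t by auto
    qed
    then have "card A = card S" unfolding A_def by (rule card_image)
    also have "card S = 1 + card ({2::nat} \<times> B \<union> {3} \<times> (?F - {\<one>}))"
      unfolding S_def using finB finite_fiber by (subst card_insert_disjoint) auto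
    also have "card ({2::nat} \<times> B \<union> {3} \<times> (?F - {\<one>})) = card B + (card ?F - 1)"
      using finB finite_fiber F1 by (subst card_Un_disjoint) (auto simp: card_cartesian_product)
    finally show ?thesis using cardB by simp
  qed
  ultimately show ?thesis using that[of A] AC by blast
qed

end

section \<open>Upper bound and value of \<open>N_max 3 (Z5_power n)\<close>\<close>

lemma pow_5_Z5_power:
  assumes "x \<in> carrier (Z5_power n)"
  shows "x [^]\<^bsub>Z5_power n\<^esub> (5::nat) = \<one>\<^bsub>Z5_power n\<^esub>"
proof -
  interpret comm_group "Z5_power n" by (rule comm_group_Z5_power)
  have "x [^]\<^bsub>Z5_power n\<^esub> k = (\<lambda>i\<in>{..<n}. (int k * x i) mod 5)" for k :: nat
  proof (induction k)
    case (Suc k)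
    then show ?case
      by (auto simp: mult_Z5_power fun_eq_iff mod_add_left_eq mod_add_right_eq algebra_simps)
  qed (simp add: one_Z5_power)
  then show ?thesis by (simp add: one_Z5_power)
qed

lemma N_max_eqI:
  assumes "A \<subseteq> carrier G" "aperiodic G A" "max_noncovering G k A" "finite (carrier G)"
    and "\<And>B. B \<subseteq> carrier G \<Longrightarrow> aperiodic G B \<Longrightarrow> max_noncovering G k B \<Longrightarrow> card B \<le> card A"
  shows "N_max k G = card A"
  unfolding N_max_def
proof (rule Max_eqI)
  have "{card B | B. B \<subseteq> carrier G \<and> aperiodic G B \<and> max_noncovering G k B} \<subseteq> card ` Pow (carrier G)"
    by auto
  then show "finite (insert 0 {card B | B. B \<subseteq> carrier G \<and> aperiodic G B \<and> max_noncovering G k B})"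
    using assms(4) by (meson finite_Pow_iff finite_imageI finite_insert finite_subset)
qed (use assms in auto)

text \<open>Beyond the threshold the set lies in two fibers; maximality and aperiodicity then make
  it two whole fibers over a trivial kernel, whose order \<open>5 ^ (n - 1)\<close> must be
  1.\<close>

lemma aperiodic_max_noncovering_large:
  assumes n: "n \<ge> 1" and A: "A \<subseteq> carrier (Z5_power n)" "aperiodic (Z5_power n) A"
    "max_noncovering (Z5_power n) 3 A" and large: "3 * 5 ^ (n - 1) < 2 * card A"
  shows "n = 1" and "card A = 2"
proof -
  obtain \<phi> p q where \<phi>: "Z5_epi (Z5_power n) \<phi>" and pq: "p \<in> {0..<5}" "q \<in> {0..<5}" "p \<noteq> q"
    and sub: "A \<subseteq> Z5_epi.fiber (Z5_power n) \<phi> p \<union> Z5_epi.fiber (Z5_power n) \<phi> q"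
    using noncovering_in_two_fibers[OF n A(1) _ large] A(3) unfolding max_noncovering_def by metis
  interpret Z5_epi "Z5_power n" \<phi> by (rule \<phi>)
  have eq: "A = fiber p \<union> fiber q" and triv: "fiber 0 = {\<one>\<^bsub>Z5_power n\<^esub>}"
    using max_noncovering_in_two_fibers[OF pq sub A(3,2)] .
  have "(5::nat) ^ n = 5 ^ 1" using card_fiber[of 0] order_Z5_power[of n] triv by simp
  then show "n = 1" by (simp only: power_inject_exp)
  have "fiber p \<inter> fiber q = {}" using pq by (auto simp: fiber_def)
  then show "card A = 2"
    using eq triv card_fiber_eq[OF pq(1)] card_fiber_eq[OF pq(2)] finite_fiber
    by (simp add: card_Un_disjoint)
qed

theorem theorem5:
  fixes n :: nat
  assumes "n \<ge> 1"
  shows "(\<forall>A. A \<subseteq> carrier (Z5_power n) \<and>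
            fold_sumset (Z5_power n) 3 A \<noteq> carrier (Z5_power n) \<and>
            real (card A) > 3 * 5 ^ (n - 1) / 2 \<longrightarrow>
            (\<exists>H. subgroup H (Z5_power n) \<and> card (rcosets\<^bsub>Z5_power n\<^esub> H) = 5 \<and>
              (\<exists>C \<in> rcosets\<^bsub>Z5_power n\<^esub> H. \<exists>D \<in> rcosets\<^bsub>Z5_power n\<^esub> H.
                 C \<noteq> D \<and> A \<subseteq> C \<union> D))) \<and>
         real (N_max 3 (Z5_power n)) =
           (if n = 1 then 2 else (3 * 5 ^ (n - 1) - 1) / 2)"
proof (intro conjI allI impI)
  fix A assume "A \<subseteq> carrier (Z5_power n) \<and>
      fold_sumset (Z5_power n) 3 A \<noteq> carrier (Z5_power n) \<and> real (card A) > 3 * 5 ^ (n - 1) / 2"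
  then have A: "A \<subseteq> carrier (Z5_power n)" "fold_sumset (Z5_power n) 3 A \<noteq> carrier (Z5_power n)"
    and "real (card A) > 3 * 5 ^ (n - 1) / 2" by auto
  then have "real (3 * 5 ^ (n - 1)) < real (2 * card A)" by simp
  then have "3 * 5 ^ (n - 1) < 2 * card A" by (simp only: of_nat_less_iff)
  then obtain \<phi> p q where \<phi>: "Z5_epi (Z5_power n) \<phi>" and pq: "p \<in> {0..<5}" "q \<in> {0..<5}" "p \<noteq> q"
    and sub: "A \<subseteq> Z5_epi.fiber (Z5_power n) \<phi> p \<union> Z5_epi.fiber (Z5_power n) \<phi> q"
    using noncovering_in_two_fibers[OF assms A] by metis
  interpret Z5_epi "Z5_power n" \<phi> by (rule \<phi>)
  obtain x where "x \<in> carrier (Z5_power n)" "\<phi> x = p" using phi_surj[OF pq(1)] .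
  then have "fiber p \<noteq> fiber q" using pq by (auto simp: fiber_def)
  then show "\<exists>H. subgroup H (Z5_power n) \<and> card (rcosets\<^bsub>Z5_power n\<^esub> H) = 5 \<and>
      (\<exists>C \<in> rcosets\<^bsub>Z5_power n\<^esub> H. \<exists>D \<in> rcosets\<^bsub>Z5_power n\<^esub> H. C \<noteq> D \<and> A \<subseteq> C \<union> D)"
    using subgroup_fiber_0 card_rcosets_fiber_0 fiber_in_rcosets[OF pq(1)] fiber_in_rcosets[OF pq(2)] sub
    by blast
next
  \<comment> \<open>Any nonzero vector serves to fix one subgroup of index 5; coordinate 0 exists
    because \<open>n \<ge> 1\<close>.\<close>
  define u where "u = (\<lambda>i\<in>{..<n}. 1 :: int)"
  have "u 0 = 1" "\<one>\<^bsub>Z5_power n\<^esub> 0 = 0" using assms by (simp_all add: u_def one_Z5_power)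
  then have "u \<noteq> \<one>\<^bsub>Z5_power n\<^esub>" by force
  moreover have "u \<in> carrier (Z5_power n)" by (auto simp: u_def carrier_Z5_power)
  ultimately interpret Z5_epi "Z5_power n" "dot n u" by (intro Z5_epi_dot)
  have "(5::nat) ^ n = 5 * 5 ^ (n - 1)" using assms by (cases n) auto
  then have m: "card (fiber 0) = 5 ^ (n - 1)" using card_fiber[of 0] order_Z5_power[of n] by simp
  show "real (N_max 3 (Z5_power n)) = (if n = 1 then 2 else (3 * 5 ^ (n - 1) - 1) / 2)"
  proof (cases "n = 1")
    case True
    have "card (fiber 0) = 1" using m True by simp
    moreover have "\<one>\<^bsub>Z5_power n\<^esub> \<in> fiber 0" using subgroup.one_closed[OF subgroup_fiber_0] .
    ultimately have triv: "fiber 0 = {\<one>\<^bsub>Z5_power n\<^esub>}" by (metis card_1_singletonE singletonD)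
    note two = two_fibers_max_noncovering[OF triv]
    have "N_max 3 (Z5_power n) = card (fiber 0 \<union> fiber 1)"
    proof (rule N_max_eqI)
      show "fiber 0 \<union> fiber 1 \<subseteq> carrier (Z5_power n)" by (auto simp: fiber_def)
      \<comment> \<open>Here the threshold is \<open>3 < 2 * card B\<close>: a set above it has two
        elements, any other at most one.\<close>
      show "card B \<le> card (fiber 0 \<union> fiber 1)" if "B \<subseteq> carrier (Z5_power n)"
        "aperiodic (Z5_power n) B" "max_noncovering (Z5_power n) 3 B" for B
        using aperiodic_max_noncovering_large(2)[OF assms that] two(3) True by fastforce
    qed (use two finite_carrier in auto)
    then show ?thesis using two True by simp
  next
    case False
    then have "5 ^ 1 \<le> (5::nat) ^ (n - 1)" using assms by (intro power_increasing) auto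
    then have "5 \<le> card (fiber 0)" using m by simp
    from aperiodic_max_noncovering_exists[OF pow_5_Z5_power this]
    obtain A where A: "A \<subseteq> carrier (Z5_power n)" "aperiodic (Z5_power n) A"
      "max_noncovering (Z5_power n) 3 A" "2 * card A + 1 = 3 * card (fiber 0)" by metis
    have "N_max 3 (Z5_power n) = card A"
    proof (rule N_max_eqI)
      \<comment> \<open>Since \<open>n \<noteq> 1\<close>, no candidate exceeds the threshold, so
        \<open>2 * card B \<le> 3 * 5 ^ (n - 1) = 2 * card A + 1\<close>, and parity gives the
        bound.\<close>
      show "card B \<le> card A" if "B \<subseteq> carrier (Z5_power n)"
        "aperiodic (Z5_power n) B" "max_noncovering (Z5_power n) 3 B" for B
        using aperiodic_max_noncovering_large(1)[OF assms that] False A(4) m by fastforce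
    qed (use A finite_carrier in auto)
    moreover have "real (2 * card A + 1) = 3 * 5 ^ (n - 1)" using A(4) m by simp
    ultimately show ?thesis using False by simp
  qed
qed

end
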